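(* Let $\nu_0=n-\nu_1-\cdots-\nu_p$, write $\mathcal R_0(\lambda_{0,k})=\mathcal R(\lambda_{0,k})$, and assume that $\dim\big(\sum_{(i,j)\in P}\mathcal R_i(\lambda_{i,j})\big)\ge\operatorname{card}P$ for all subsets $P$ of $I=\{(0,1),\ldots,(0,\nu_0),\ldots,(p,1),\ldots,(p,\nu_p)\}$. For $k\in\{1,\ldots,\nu_0\}$ let $\begin{bmatrix} V_{0,k} \\ W_{0,k} \end{bmatrix}$ be a basis matrix for $\ker\begin{bmatrix} A-\lambda_{0,k}I & B \\ C & D \end{bmatrix}$, and for $i\in\{1,\ldots,p\}$, $j\in\{1,\ldots,\nu_i\}$ let $\begin{bmatrix} V_{i,j} \\ W_{i,j} \end{bmatrix}$ be a basis matrix for $\ker\begin{bmatrix} A-\lambda_{i,j}I & B \\ C_{(i)} & D_{(i)} \end{bmatrix}$ (partitioned so that the upper blocks have $n$ rows). For real parameter vectors $k_{i,j}$ of suitable size ($i\in\{0,\ldots,p\}$, $j\in\{1,\ldots,\nu_i\}$) define $$V_{k_{i,j}}=\big[\,V_{0,1}k_{0,1}\ \cdots\ V_{0,\nu_0}k_{0,\nu_0}\ |\ \cdots\ |\ V_{p,1}k_{p,1}\ \cdots\ V_{p,\nu_p}k_{p,\nu_p}\,\big],$$ $$W_{k_{i,j}}=\big[\,W_{0,1}k_{0,1}\ \cdots\ W_{0,\nu_0}k_{0,\nu_0}\ |\ \cdots\ |\ W_{p,1}k_{p,1}\ \cdots\ W_{p,\nu_p}k_{p,\nu_p}\,\big].$$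 Then: 1. the rank of $V_{k_{i,j}}$ equals $n$ for almost all parameters $k_{i,j}$; 2. for almost all $k_{i,j}$ such that $\operatorname{rank}V_{k_{i,j}}=n$, the feedback matrix $F=W_{k_{i,j}}V_{k_{i,j}}^{-1}$ solves Problem 1A (stated in the context).
   Context: "Almost all" is with respect to Lebesgue measure on the space of parameters. System: $\Sigma=(A,B,C,D)$ is $\mathcal D x=Ax+Bu$, $y=Cx+Du$, $x(t)\in\mathbb R^n$, $u(t)\in\mathbb R^m$, $y(t)\in\mathbb R^p$, real matrices; $\mathcal D x=\dot x$ (continuous time) or $x(t+1)$ (discrete time). $\mathbb C_g$ is the open left half-plane (continuous) or open unit disc (discrete), $\mathbb R_g=\mathbb C_g\cap\mathbb R$. $\mathcal Z$ is the set of invariant zeros of $\Sigma$: those $\lambda\in\mathbb C$ at which the rank of $\begin{bmatrix} A-\lambda I & B \\ C & D \end{bmatrix}$ is below its normal rank; minimum-phase zeros are those in $\mathbb C_g$. Standing assumptions: $\Sigma$ is right invertible (that matrix pencil has full row rank for all but finitely many $\lambda$), stabilizable, with no invariant zero at $0$ (continuous) or $1$ (discrete); algebraic and geometric multiplicities of each minimum-phase invariant zero coincide; no Jordan chains are allowed in the closed loop ($A+BF$ diagonalizable); in this part all closed-loop eigenvalues considered and all minimum-phase invariant zeros are real. Control: $u=Fx+Gr$, $F$ real with $\sigma(A+BF)\subset\mathbb C_g$, $G$ a right inverse of the closed-loop static gain. For constant $r$, $\epsilon=y-r$ satisfies $\mathcal D\xi=(A+BF)\xi$, $\epsilon=(C+DF)\xi$.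 State-to-output decoupling: for any initial condition, $\epsilon_i(t)=\sum_{j=1}^{\nu_i}\beta_{i,j}e^{\lambda_{i,j}t}$ (resp. $\sum_j\beta_{i,j}\lambda_{i,j}^t$), $i=1,\ldots,p$, where the $\lambda_{i,j}$ are the observable closed-loop eigenvalues and the coefficients $\beta_{i,j}$ can be made arbitrary by choice of $\xi(0)$. That is, $A+BF$ has a basis of eigenvectors $v_{0,1},\ldots,v_{0,\nu_0},v_{1,1},\ldots,v_{p,\nu_p}$ with eigenvalues $\lambda_{i,j}$ such that $(C+DF)v_{0,j}=0$ and $(C+DF)v_{i,j}$ is a nonzero multiple of the $i$-th canonical vector $e_i\in\mathbb R^p$ for $i\ge1$; the $\lambda_{i,j}$ ($1\le j\le\nu_i$) are the eigenvalues observable from $\epsilon_i$ and the $\lambda_{0,j}$ the unobservable ones (all counted with multiplicity). Problem 1A: given nonnegative integers $\nu_1,\ldots,\nu_p$ with $\nu_0=n-\sum_i\nu_i\ge0$, and assigned $\lambda_{i,j}\in\mathbb R_g\setminus\mathcal Z$ ($i=1,\ldots,p$, $j=1,\ldots,\nu_i$) and $\lambda_{0,j}\in\mathbb R_g$ ($j=1,\ldots,\nu_0$), find $F,G$ such that: (1) $y(t)\to\bar r$ for every constant reference $r(t)=\bar r$; (2) state-to-output decoupling is achieved; (3) from each $\epsilon_i$ exactly $\nu_i$ eigenvalues are observable and they are not invariant zeros; and the eigenvalues observable from $\epsilon_i$ are exactly $\{\lambda_{i,j}\}_{j=1,\ldots,\nu_i}$, the unobservable ones are $\{\lambda_{0,j}\}_{j=1,\ldots,\nu_0}$.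 A matrix $F$ solves the problem if, together with a matrix $G$ that is a right inverse of the closed-loop static gain (the static gain of the quadruple $(A+BF,B,C+DF,D)$), it meets these requirements. Subspaces, for real $\lambda$: $\mathcal R(\lambda)=\{v\in\mathbb R^n\mid\exists w\in\mathbb R^m:\ (A-\lambda I)v+Bw=0,\ Cv+Dw=0\}$; $\mathcal R_i(\lambda)=\{v\in\mathbb R^n\mid\exists w\in\mathbb R^m:\ (A-\lambda I)v+Bw=0,\ C_{(i)}v+D_{(i)}w=0\}$, where $C_{(i)},D_{(i)}$ are $C,D$ with the $i$-th row removed. *)

theory Defs
  imports "HOL-Analysis.Analysis" "HOL-Computational_Algebra.Field_as_Ring"
    "HOL-Computational_Algebra.Polynomial_Factorial"
begin

datatype time_domain = Continuous | Discrete

fun stability_region :: "time_domain \<Rightarrow> complex set" where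
  "stability_region Continuous = {z. Re z < 0}"
| "stability_region Discrete = {z. cmod z < 1}"

definition real_stability_region :: "time_domain \<Rightarrow> real set" where
  "real_stability_region td = {x. complex_of_real x \<in> stability_region td}"

fun steady_state_point :: "time_domain \<Rightarrow> complex" where
  "steady_state_point Continuous = 0"
| "steady_state_point Discrete = 1"


subsection \<open>System matrix pencil and invariant zeros\<close>

text \<open>The system is a quadruple of real matrices
  \<open>A :: real^'n^'n\<close>, \<open>B :: real^'m^'n\<close>, \<open>C :: real^'n^'p\<close>, \<open>D :: real^'m^'p\<close>
  (the row index is the outermost one).  The pencil is a polynomial matrix whose rows and columns
  are indexed by the disjoint sums \<open>'n + 'p\<close> and \<open>'n + 'm\<close>.\<close>

definition system_pencil ::
  "real^'n^'n \<Rightarrow> real^'m^'n \<Rightarrow> real^'n^'p \<Rightarrow> real^'m^'p \<Rightarrow> complex poly^('n + 'm)^('n + 'p)" where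
  "system_pencil A B C D = (\<chi> r c. case (r, c) of
      (Inl i, Inl j) \<Rightarrow> [:complex_of_real (A $ i $ j), - (if i = j then 1 else 0):]
    | (Inl i, Inr j) \<Rightarrow> [:complex_of_real (B $ i $ j):]
    | (Inr i, Inl j) \<Rightarrow> [:complex_of_real (C $ i $ j):]
    | (Inr i, Inr j) \<Rightarrow> [:complex_of_real (D $ i $ j):])"

definition eval_pmat :: "'a::comm_semiring_0 poly^'c^'r \<Rightarrow> 'a \<Rightarrow> 'a^'c^'r" where
  "eval_pmat P z = (\<chi> r c. poly (P $ r $ c) z)"

definition normal_rank :: "complex poly^'c^'r \<Rightarrow> nat" where
  "normal_rank P = Max (range (\<lambda>z. rank (eval_pmat P z)))"

definition invariant_zeros ::
  "real^'n^'n \<Rightarrow> real^'m^'n \<Rightarrow> real^'n^'p \<Rightarrow> real^'m^'p \<Rightarrow> complex set" where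
  "invariant_zeros A B C D =
     {z. rank (eval_pmat (system_pencil A B C D) z) < normal_rank (system_pencil A B C D)}"

definition right_invertible ::
  "real^'n^'n \<Rightarrow> real^'m^'n \<Rightarrow> real^'n^'p \<Rightarrow> real^'m^'p \<Rightarrow> bool" where
  "right_invertible A B C D \<longleftrightarrow>
     finite {z. rank (eval_pmat (system_pencil A B C D) z) \<noteq> CARD('n) + CARD('p)}"

text \<open>Algebraic multiplicity of an invariant zero: its multiplicity as a root of the product of
  the invariant polynomials (Smith form) of the pencil, i.e. of the greatest common divisor of
  all minors whose order is the normal rank.  Geometric multiplicity: the drop of rank.\<close>

definition minor :: "'a::comm_ring_1^'c^'r \<Rightarrow> nat \<Rightarrow> (nat \<Rightarrow> 'r) \<Rightarrow> (nat \<Rightarrow> 'c) \<Rightarrow> 'a" where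
  "minor M k f g =
     (\<Sum>\<sigma> | \<sigma> permutes {..<k}. of_int (sign \<sigma>) * (\<Prod>i<k. M $ f i $ g (\<sigma> i)))"

definition zero_polynomial :: "complex poly^'c^'r \<Rightarrow> complex poly" where
  "zero_polynomial P = Gcd {minor P (normal_rank P) f g | f g.
     inj_on f {..<normal_rank P} \<and> inj_on g {..<normal_rank P}}"

definition algebraic_multiplicity ::
  "real^'n^'n \<Rightarrow> real^'m^'n \<Rightarrow> real^'n^'p \<Rightarrow> real^'m^'p \<Rightarrow> complex \<Rightarrow> nat" where
  "algebraic_multiplicity A B C D z = order z (zero_polynomial (system_pencil A B C D))"

definition geometric_multiplicity ::
  "real^'n^'n \<Rightarrow> real^'m^'n \<Rightarrow> real^'n^'p \<Rightarrow> real^'m^'p \<Rightarrow> complex \<Rightarrow> nat" where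
  "geometric_multiplicity A B C D z =
     normal_rank (system_pencil A B C D) - rank (eval_pmat (system_pencil A B C D) z)"


subsection \<open>Closed loop\<close>

definition spectrum :: "real^'n^'n \<Rightarrow> complex set" where
  "spectrum M = {z. \<exists>v. v \<noteq> 0 \<and> (\<chi> i j. complex_of_real (M $ i $ j)) *v v = z *s v}"

definition stabilizable :: "time_domain \<Rightarrow> real^'n^'n \<Rightarrow> real^'m^'n \<Rightarrow> bool" where
  "stabilizable td A B \<longleftrightarrow> (\<exists>F :: real^'n^'m. spectrum (A + B ** F) \<subseteq> stability_region td)"

fun static_gain ::
  "time_domain \<Rightarrow> real^'n^'n \<Rightarrow> real^'m^'n \<Rightarrow> real^'n^'p \<Rightarrow> real^'m^'p \<Rightarrow> real^'m^'p" where
  "static_gain Continuous A B C D = D - C ** matrix_inv A ** B"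
| "static_gain Discrete A B C D = D + C ** matrix_inv (mat 1 - A) ** B"

fun tracks_constants ::
  "time_domain \<Rightarrow> real^'n^'n \<Rightarrow> real^'m^'n \<Rightarrow> real^'n^'p \<Rightarrow> real^'m^'p \<Rightarrow>
   real^'n^'m \<Rightarrow> real^'p^'m \<Rightarrow> bool" where
  "tracks_constants Continuous A B C D F G \<longleftrightarrow>
     (\<forall>r (x :: real \<Rightarrow> real^'n) (u :: real \<Rightarrow> real^'m).
        (\<forall>t\<ge>0. u t = F *v x t + G *v r) \<longrightarrow>
        (\<forall>t\<ge>0. (x has_vector_derivative A *v x t + B *v u t) (at t within {0..})) \<longrightarrow>
        ((\<lambda>t. C *v x t + D *v u t) \<longlongrightarrow> r) at_top)"
| "tracks_constants Discrete A B C D F G \<longleftrightarrow>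
     (\<forall>r (x :: nat \<Rightarrow> real^'n) (u :: nat \<Rightarrow> real^'m).
        (\<forall>t. u t = F *v x t + G *v r) \<longrightarrow>
        (\<forall>t. x (Suc t) = A *v x t + B *v u t) \<longrightarrow>
        (\<lambda>t. C *v x t + D *v u t) \<longlonglongrightarrow> r)"

text \<open>Eigenvalue families are indexed by pairs \<open>(i, j)\<close> with \<open>1 \<le> j \<le> \<nu> i\<close>, where
  \<open>i = Some l\<close> stands for the \<open>l\<close>-th output and \<open>i = None\<close> for the index 0
  of the unobservable eigenvalues.\<close>

definition eig_index :: "('p option \<Rightarrow> nat) \<Rightarrow> ('p option \<times> nat) set" where
  "eig_index \<nu> = {(i, j). j \<in> {1..\<nu> i}}"

text \<open>The tracking error \<open>\<epsilon> = y - r\<close> is the output of the autonomous closed loop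
  with state \<open>\<xi>\<close>.  In discrete time the mode at \<open>t = 0\<close> is \<open>lam ^ 0 = 1\<close> also for \<open>lam = 0\<close>.\<close>

fun error_decoupled ::
  "time_domain \<Rightarrow> real^'n^'n \<Rightarrow> real^'m^'n \<Rightarrow> real^'n^'p \<Rightarrow> real^'m^'p \<Rightarrow>
   ('p option \<Rightarrow> nat) \<Rightarrow> ('p option \<Rightarrow> nat \<Rightarrow> real) \<Rightarrow> real^'n^'m \<Rightarrow> bool" where
  "error_decoupled Continuous A B C D \<nu> lam F \<longleftrightarrow>
     (let is_traj = (\<lambda>\<xi> :: real \<Rightarrow> real^'n. \<forall>t\<ge>0.
            (\<xi> has_vector_derivative (A + B ** F) *v \<xi> t) (at t within {0..}));
          is_modal = (\<lambda>(\<xi> :: real \<Rightarrow> real^'n) (\<beta> :: 'p \<Rightarrow> nat \<Rightarrow> real). \<forall>t\<ge>0. \<forall>i.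
            ((C + D ** F) *v \<xi> t) $ i =
              (\<Sum>j = 1..\<nu> (Some i). \<beta> i j * exp (lam (Some i) j * t)))
      in (\<forall>\<xi>. is_traj \<xi> \<longrightarrow> (\<exists>\<beta>. is_modal \<xi> \<beta>)) \<and> (\<forall>\<beta>. \<exists>\<xi>. is_traj \<xi> \<and> is_modal \<xi> \<beta>))"
| "error_decoupled Discrete A B C D \<nu> lam F \<longleftrightarrow>
     (let is_traj = (\<lambda>\<xi> :: nat \<Rightarrow> real^'n. \<forall>t. \<xi> (Suc t) = (A + B ** F) *v \<xi> t);
          is_modal = (\<lambda>(\<xi> :: nat \<Rightarrow> real^'n) (\<beta> :: 'p \<Rightarrow> nat \<Rightarrow> real). \<forall>t i.
            ((C + D ** F) *v \<xi> t) $ i =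
              (\<Sum>j = 1..\<nu> (Some i). \<beta> i j * lam (Some i) j ^ t))
      in (\<forall>\<xi>. is_traj \<xi> \<longrightarrow> (\<exists>\<beta>. is_modal \<xi> \<beta>)) \<and> (\<forall>\<beta>. \<exists>\<xi>. is_traj \<xi> \<and> is_modal \<xi> \<beta>))"

text \<open>The closed loop is diagonalizable over the reals, the eigenvalues \<open>lam (Some i) j\<close> are those
  observable from the \<open>i\<close>-th error component only, and the \<open>lam None j\<close> are the unobservable ones.\<close>

definition eigenstructure_assigned ::
  "real^'n^'n \<Rightarrow> real^'m^'n \<Rightarrow> real^'n^'p \<Rightarrow> real^'m^'p \<Rightarrow>
   ('p option \<Rightarrow> nat) \<Rightarrow> ('p option \<Rightarrow> nat \<Rightarrow> real) \<Rightarrow> real^'n^'m \<Rightarrow> bool" where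
  "eigenstructure_assigned A B C D \<nu> lam F \<longleftrightarrow>
     (\<exists>v :: 'p option \<times> nat \<Rightarrow> real^'n.
        inj_on v (eig_index \<nu>) \<and> independent (v ` eig_index \<nu>) \<and> span (v ` eig_index \<nu>) = UNIV \<and>
        (\<forall>(i, j)\<in>eig_index \<nu>. (A + B ** F) *v v (i, j) = lam i j *\<^sub>R v (i, j)) \<and>
        (\<forall>j\<in>{1..\<nu> None}. (C + D ** F) *v v (None, j) = 0) \<and>
        (\<forall>i. \<forall>j\<in>{1..\<nu> (Some i)}. \<exists>c. c \<noteq> 0 \<and> (C + D ** F) *v v (Some i, j) = c *\<^sub>R axis i 1))"

definition solves_problem_1A ::
  "time_domain \<Rightarrow> real^'n^'n \<Rightarrow> real^'m^'n \<Rightarrow> real^'n^'p \<Rightarrow> real^'m^'p \<Rightarrow>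
   ('p option \<Rightarrow> nat) \<Rightarrow> ('p option \<Rightarrow> nat \<Rightarrow> real) \<Rightarrow> real^'n^'m \<Rightarrow> bool" where
  "solves_problem_1A td A B C D \<nu> lam F \<longleftrightarrow>
     (\<exists>G :: real^'p^'m.
        spectrum (A + B ** F) \<subseteq> stability_region td \<and>
        static_gain td (A + B ** F) B (C + D ** F) D ** G = mat 1 \<and>
        tracks_constants td A B C D F G \<and>
        error_decoupled td A B C D \<nu> lam F \<and>
        eigenstructure_assigned A B C D \<nu> lam F \<and>
        (\<forall>i. \<forall>j\<in>{1..\<nu> (Some i)}. complex_of_real (lam (Some i) j) \<notin> invariant_zeros A B C D))"


subsection \<open>Subspaces and parametrization\<close>

text \<open>Kernel of the pencil at a real point \<open>s\<close>, with the \<open>l\<close>-th row of \<open>[C D]\<close> removed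
  for \<open>i = Some l\<close>, and of the full pencil for \<open>i = None\<close>.  The two components are the blocks
  of a vector of the kernel.\<close>

definition pencil_kernel ::
  "real^'n^'n \<Rightarrow> real^'m^'n \<Rightarrow> real^'n^'p \<Rightarrow> real^'m^'p \<Rightarrow> 'p option \<Rightarrow> real \<Rightarrow>
   ((real^'n) \<times> (real^'m)) set" where
  "pencil_kernel A B C D i s =
     {(v, w). (A - mat s) *v v + B *v w = 0 \<and>
              (\<forall>l. i \<noteq> Some l \<longrightarrow> (C *v v + D *v w) $ l = 0)}"

definition reach_space ::
  "real^'n^'n \<Rightarrow> real^'m^'n \<Rightarrow> real^'n^'p \<Rightarrow> real^'m^'p \<Rightarrow> 'p option \<Rightarrow> real \<Rightarrow> (real^'n) set" where
  "reach_space A B C D i s = {v. \<exists>w. (v, w) \<in> pencil_kernel A B C D i s}"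

definition subspace_sum :: "('k \<Rightarrow> 'a::comm_monoid_add set) \<Rightarrow> 'k set \<Rightarrow> 'a set" where
  "subspace_sum R P = {(\<Sum>q\<in>P. f q) | f. \<forall>q\<in>P. f q \<in> R q}"

text \<open>\<open>V 1, \<dots>, V d\<close> and \<open>W 1, \<dots>, W d\<close> are the columns of the two blocks of a basis matrix.\<close>

definition is_basis_matrix ::
  "nat \<Rightarrow> (nat \<Rightarrow> real^'n) \<Rightarrow> (nat \<Rightarrow> real^'m) \<Rightarrow> ((real^'n) \<times> (real^'m)) set \<Rightarrow> bool" where
  "is_basis_matrix d V W S \<longleftrightarrow>
     inj_on (\<lambda>l. (V l, W l)) {1..d} \<and>
     independent ((\<lambda>l. (V l, W l)) ` {1..d}) \<and>
     span ((\<lambda>l. (V l, W l)) ` {1..d}) = S"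

text \<open>Lebesgue measure on the space of all parameters: the entry \<open>l\<close> of the parameter vector
  \<open>k\<^sub>i\<^sub>,\<^sub>j\<close> is \<open>k (i, j, l)\<close>, with \<open>d i j\<close> the number of columns of the \<open>(i, j)\<close>-th basis matrix.\<close>

definition param_measure ::
  "('p option \<Rightarrow> nat) \<Rightarrow> ('p option \<Rightarrow> nat \<Rightarrow> nat) \<Rightarrow> ('p option \<times> nat \<times> nat \<Rightarrow> real) measure" where
  "param_measure \<nu> d =
     (\<Pi>\<^sub>M q \<in> {(i, j, l). j \<in> {1..\<nu> i} \<and> l \<in> {1..d i j}}. (lborel :: real measure))"

text \<open>The matrix whose columns are the combinations \<open>\<Sum>\<^sub>l k (i, j, l) \<cdot> b i j l\<close>; the bijection
  \<open>\<phi>\<close> between the column indices and the pairs \<open>(i, j)\<close> fixes the order of the columns.\<close>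

definition param_matrix ::
  "('c \<Rightarrow> 'p option \<times> nat) \<Rightarrow> ('p option \<Rightarrow> nat \<Rightarrow> nat) \<Rightarrow>
   ('p option \<Rightarrow> nat \<Rightarrow> nat \<Rightarrow> real^'r) \<Rightarrow> ('p option \<times> nat \<times> nat \<Rightarrow> real) \<Rightarrow> real^'c^'r" where
  "param_matrix \<phi> d b k =
     (\<chi> r c. case \<phi> c of (i, j) \<Rightarrow> (\<Sum>l = 1..d i j. k (i, j, l) *\<^sub>R b i j l) $ r)"

end

theory Submission
  imports Defs
begin

text \<open>Rado's theorem turns the dimension condition into one parameter value at which the columns
  are linearly independent, so the determinant is a nonzero polynomial in the parameters and vanishes
  only on a null set.  If \<open>lam (Some i) j\<close> is not an invariant zero, the pencil is surjective there,
  so some kernel element of the reduced pencil has a nonzero \<open>i\<close>-th output; this too is generic.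
  With \<open>F = W V\<inverse>\<close> the columns of \<open>V\<close> are then closed-loop eigenvectors with the prescribed
  output directions, and everything else is read off in this eigenbasis.\<close>

lemma dim_Un_submodular:
  fixes X Y Z :: "'a::euclidean_space set"
  assumes "Z \<subseteq> X" "Z \<subseteq> Y"
  shows "dim (X \<union> Y) + dim Z \<le> dim X + dim Y"
proof -
  have "dim (X \<union> Y) + dim (span X \<inter> span Y) = dim X + dim Y"
    using dim_sums_Int[of "span X" "span Y"] dim_span[of "X \<union> Y"]
    by (simp add: span_Un subspace_span)
  moreover have "dim Z \<le> dim (span X \<inter> span Y)"
    using assms by (intro dim_subset) (auto intro: span_base)
  ultimately show ?thesis by linarith
qed

lemma independent_image_if_card_le_dim:
  fixes v :: "'i \<Rightarrow> 'a::euclidean_space"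
  assumes "finite I" "card I \<le> dim (v ` I)"
  shows "inj_on v I \<and> independent (v ` I)"
proof -
  have fin: "finite (v ` I)" using assms(1) by simp
  have 1: "card (v ` I) \<le> card I" by (rule card_image_le[OF assms(1)])
  have 2: "dim (v ` I) \<le> card (v ` I)" by (rule dim_le_card'[OF fin])
  have "card (v ` I) = card I" using 1 2 assms(2) by linarith
  then have "inj_on v I" by (rule eq_card_imp_inj_on[OF assms(1)])
  moreover have "independent (v ` I)"
  proof (rule card_le_dim_spanning[of _ "span (v ` I)"])
    show "card (v ` I) \<le> dim (span (v ` I))" using 1 assms(2) by simp
  qed (use fin in \<open>auto intro: span_base\<close>)
  ultimately show ?thesis by blast
qed

text \<open>Two different vectors \<open>x, y \<in> S q\<close> cannot both be indispensable: violating index sets for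
  \<open>S q - {x}\<close> and \<open>S q - {y}\<close> would contradict submodularity of the dimension.  So the sets can
  be shrunk one vector at a time until they are singletons.\<close>

theorem rado_independent_transversal:
  fixes S :: "'i \<Rightarrow> 'a::euclidean_space set"
  assumes "finite I" "\<And>q. q \<in> I \<Longrightarrow> finite (S q)"
    and "\<And>P. P \<subseteq> I \<Longrightarrow> card P \<le> dim (\<Union>(S ` P))"
  shows "\<exists>v. (\<forall>q\<in>I. v q \<in> S q) \<and> inj_on v I \<and> independent (v ` I)"
  using assms(2,3)
proof (induction "\<Sum>q\<in>I. card (S q)" arbitrary: S rule: less_induct)
  case less
  show ?case
  proof (cases "\<exists>q\<in>I. \<exists>x\<in>S q. \<exists>y\<in>S q. x \<noteq> y")
    case False
    have "S q \<noteq> {}" if "q \<in> I" for q using less.prems(2)[of "{q}"] that by auto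
    then have "\<forall>q\<in>I. \<exists>x. x \<in> S q" by blast
    then obtain v where v: "\<forall>q\<in>I. v q \<in> S q" using bchoice[of I "\<lambda>q x. x \<in> S q"] by blast
    have "S q = {v q}" if "q \<in> I" for q using v False that by blast
    then have "\<Union>(S ` I) = v ` I" by auto
    with less.prems(2)[of I] have "card I \<le> dim (v ` I)" by simp
    then show ?thesis using independent_image_if_card_le_dim[OF assms(1)] v by blast
  next
    case True
    then obtain q x y where q: "q \<in> I" "x \<in> S q" "y \<in> S q" "x \<noteq> y" by blast
    define S' where "S' z = S(q := S q - {z})" for z
    have fin: "finite (S' z p)" if "p \<in> I" for z p
      using less.prems(1)[OF that] q less.prems(1)[of q] by (auto simp: S'_def)
    have smaller: "(\<Sum>p\<in>I. card (S' z p)) < (\<Sum>p\<in>I. card (S p))" if "z \<in> S q" for z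
    proof (rule sum_strict_mono_ex1[OF assms(1)])
      show "\<forall>p\<in>I. card (S' z p) \<le> card (S p)"
        using less.prems(1) by (auto simp: S'_def intro: card_Diff1_le)
      show "\<exists>p\<in>I. card (S' z p) < card (S p)"
        using card_Diff1_less[OF less.prems(1)[OF q(1)] that] q(1) by (auto simp: S'_def)
    qed
    have step: ?thesis if z: "z \<in> S q" and h: "\<And>P. P \<subseteq> I \<Longrightarrow> card P \<le> dim (\<Union>(S' z ` P))" for z
    proof -
      obtain v where "\<forall>p\<in>I. v p \<in> S' z p" "inj_on v I \<and> independent (v ` I)"
        using less.hyps[OF smaller[OF z] fin h] by blast
      moreover have "S' z p \<subseteq> S p" for p by (auto simp: S'_def)
      ultimately show ?thesis by blast
    qed
    have violation: "\<exists>T \<subseteq> I - {q}. dim ((S q - {z}) \<union> \<Union>(S ` T)) \<le> card T"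
      if bad: "\<not> (\<forall>P \<subseteq> I. card P \<le> dim (\<Union>(S' z ` P)))" for z
    proof -
      obtain P where P: "P \<subseteq> I" "dim (\<Union>(S' z ` P)) < card P" using bad by (metis linorder_not_le)
      have finP: "finite P" using P(1) assms(1) by (rule finite_subset)
      have qP: "q \<in> P"
      proof (rule ccontr)
        assume "q \<notin> P"
        then have "S' z ` P = S ` P" by (auto simp: S'_def)
        then show False using less.prems(2)[OF P(1)] P(2) by simp
      qed
      have "\<Union>(S' z ` P) = (S q - {z}) \<union> \<Union>(S ` (P - {q}))"
        using qP by (auto simp: S'_def split: if_splits)
      moreover have "card P = Suc (card (P - {q}))" using card.remove[OF finP qP] by simp
      ultimately show ?thesis using P by (intro exI[of _ "P - {q}"]) auto
    qed
    show ?thesis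
    proof (cases "(\<forall>P \<subseteq> I. card P \<le> dim (\<Union>(S' x ` P))) \<or> (\<forall>P \<subseteq> I. card P \<le> dim (\<Union>(S' y ` P)))")
      case True
      then show ?thesis using step q by blast
    next
      case False
      then obtain T1 T2 where T1: "T1 \<subseteq> I - {q}" "dim ((S q - {x}) \<union> \<Union>(S ` T1)) \<le> card T1"
        and T2: "T2 \<subseteq> I - {q}" "dim ((S q - {y}) \<union> \<Union>(S ` T2)) \<le> card T2"
        using violation by meson
      have finT: "finite T1" "finite T2" using T1 T2 assms(1) by (auto intro: finite_subset)
      have "card (insert q (T1 \<union> T2)) \<le> dim (\<Union>(S ` insert q (T1 \<union> T2)))"
        using T1 T2 q by (intro less.prems(2)) auto
      also have "\<Union>(S ` insert q (T1 \<union> T2))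
          = ((S q - {x}) \<union> \<Union>(S ` T1)) \<union> ((S q - {y}) \<union> \<Union>(S ` T2))"
        using q by auto
      finally have u: "Suc (card (T1 \<union> T2)) \<le> dim \<dots>"
        using T1 T2 finT by (subst (asm) card_insert_disjoint) auto
      have i: "card (T1 \<inter> T2) \<le> dim (\<Union>(S ` (T1 \<inter> T2)))"
        using T1 by (intro less.prems(2)) auto
      have "dim (((S q - {x}) \<union> \<Union>(S ` T1)) \<union> ((S q - {y}) \<union> \<Union>(S ` T2))) + dim (\<Union>(S ` (T1 \<inter> T2)))
          \<le> dim ((S q - {x}) \<union> \<Union>(S ` T1)) + dim ((S q - {y}) \<union> \<Union>(S ` T2))"
        by (rule dim_Un_submodular) auto
      then have "Suc (card (T1 \<union> T2)) + card (T1 \<inter> T2) \<le> card T1 + card T2"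
        using u i T1(2) T2(2) by linarith
      then show ?thesis using card_Un_Int[OF finT] by linarith
    qed
  qed
qed

lemma real_polynomial_function_finite_zeros:
  fixes f :: "real \<Rightarrow> real"
  assumes "real_polynomial_function f" "f t0 \<noteq> 0"
  shows "finite {t. f t = 0}"
proof -
  obtain a n where f: "f = (\<lambda>x. \<Sum>i\<le>n. a i * x ^ i)"
    using assms(1) unfolding real_polynomial_function_iff_sum by blast
  then have "\<exists>i\<le>n. a i \<noteq> 0" using assms(2) by (force intro: sum.neutral)
  then show ?thesis using Transcendental.polyfun_finite_roots[of a n] f by auto
qed

text \<open>Fubini reduces the claim to one variable, where a nonzero polynomial has finitely many zeros.\<close>

lemma AE_nonzero_if_separately_polynomial:
  fixes f :: "('a \<Rightarrow> real) \<Rightarrow> real"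
  assumes "finite I"
    and "f \<in> borel_measurable (\<Pi>\<^sub>M i\<in>I. lborel)"
    and "\<And>k i. i \<in> I \<Longrightarrow> real_polynomial_function (\<lambda>t. f (k(i := t)))"
    and "k0 \<in> extensional I" "f k0 \<noteq> 0"
  shows "AE k in (\<Pi>\<^sub>M i\<in>I. (lborel :: real measure)). f k \<noteq> 0"
  using assms
proof (induction I arbitrary: f k0 rule: finite_induct)
  case empty
  then show ?case by (auto simp: space_PiM intro: AE_I2)
next
  case (insert i I)
  interpret product_sigma_finite "\<lambda>_::'a. lborel :: real measure" by standard
  let ?M = "\<lambda>J. \<Pi>\<^sub>M i\<in>J. (lborel :: real measure)"
  define Z where "Z = {k \<in> space (?M (insert i I)). f k = 0}"
  have Z [measurable]: "Z \<in> sets (?M (insert i I))"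
    using insert.prems(1) unfolding Z_def by measurable
  define g where "g x = f (x(i := k0 i))" for x
  have upd [measurable]: "(\<lambda>x. x(i := c)) \<in> ?M I \<rightarrow>\<^sub>M ?M (insert i I)" for c :: real
    by (rule measurable_fun_upd[where J = I]) auto
  have "AE x in ?M I. g x \<noteq> 0"
  proof (rule insert.IH)
    show "g \<in> borel_measurable (?M I)"
      unfolding g_def using insert.prems(1) by measurable
    show "real_polynomial_function (\<lambda>t. g (k(j := t)))" if "j \<in> I" for k j
    proof -
      have "j \<noteq> i" using that insert.hyps by auto
      then have "(\<lambda>t. g (k(j := t))) = (\<lambda>t. f ((k(i := k0 i))(j := t)))"
        by (simp add: g_def fun_upd_twist)
      then show ?thesis using insert.prems(2)[of j "k(i := k0 i)"] that by (simp del: fun_upd_apply)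
    qed
    show "restrict k0 I \<in> extensional I" by simp
    have "(restrict k0 I)(i := k0 i) = k0"
      using insert.prems(3) by (auto simp: extensional_def restrict_def)
    then show "g (restrict k0 I) \<noteq> 0" using insert.prems(4) by (simp add: g_def)
  qed
  then have inner: "AE x in ?M I. (\<integral>\<^sup>+ y. indicator Z (x(i := y)) \<partial>lborel) = 0"
  proof (rule AE_mp, intro AE_I2 impI)
    fix x assume x: "x \<in> space (?M I)" "g x \<noteq> 0"
    have "finite {y. f (x(i := y)) = 0}"
      using insert.prems(2)[of i x] x(2) unfolding g_def
      by (intro real_polynomial_function_finite_zeros[of _ "k0 i"]) (simp_all del: fun_upd_apply)
    then have "AE y in lborel. y \<notin> {y. f (x(i := y)) = 0}"
      by (intro AE_not_in finite_imp_null_set_lborel)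
    then have "AE y in lborel. (indicator Z (x(i := y)) :: ennreal) = 0"
      by (rule AE_mp) (auto simp: Z_def)
    then have "(\<integral>\<^sup>+ y. indicator Z (x(i := y)) \<partial>lborel) = (\<integral>\<^sup>+ y. 0 \<partial>(lborel :: real measure))"
      by (rule nn_integral_cong_AE)
    then show "(\<integral>\<^sup>+ y. indicator Z (x(i := y)) \<partial>lborel) = 0" by simp
  qed
  have "emeasure (?M (insert i I)) Z = (\<integral>\<^sup>+ k. indicator Z k \<partial>?M (insert i I))" by simp
  also have "\<dots> = (\<integral>\<^sup>+ x. \<integral>\<^sup>+ y. indicator Z (x(i := y)) \<partial>lborel \<partial>?M I)"
    by (rule product_nn_integral_insert) (use insert.hyps in auto)
  also have "\<dots> = (\<integral>\<^sup>+ x. 0 \<partial>?M I)" by (rule nn_integral_cong_AE[OF inner])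
  finally have "Z \<in> null_sets (?M (insert i I))" using Z by (simp add: null_setsI)
  then have "AE k in ?M (insert i I). k \<notin> Z" by (rule AE_not_in)
  with AE_space show ?case by eventually_elim (simp add: Z_def)
qed

lemma rank_le_rows: "rank (M :: 'a::field^'c^'r) \<le> CARD('r)"
proof -
  have row_image: "rows M = range (\<lambda>i. row i M)" by (auto simp: rows_def)
  have "rank M \<le> card (rows M)"
    unfolding row_rank_def_gen by (rule vec.dim_le_card') (simp add: row_image)
  also have "\<dots> \<le> CARD('r)"
    unfolding row_image using card_image_le[of UNIV "\<lambda>i. row i M"] by simp
  finally show ?thesis .
qed

lemma surj_if_rank_eq_rows:
  fixes M :: "'a::field^'c^'r"
  assumes "rank M = CARD('r)"
  shows "surj ((*v) M)"
proof -
  have rows: "rows M = range (\<lambda>i. row i M)" by (auto simp: rows_def)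
  have fin: "finite (rows M)" by (simp add: rows)
  have le: "card (rows M) \<le> CARD('r)" unfolding rows by (rule card_image_le) simp
  have ge: "CARD('r) \<le> vec.dim (rows M)" using assms by (simp add: row_rank_def_gen)
  have "card (rows M) = CARD('r)" using le ge vec.dim_le_card'[OF fin] by linarith
  then have inj: "inj (\<lambda>i. row i M)" unfolding rows by (intro eq_card_imp_inj_on) auto
  have ind: "vec.independent (rows M)"
    using le ge fin by (intro vec.card_le_dim_spanning[of _ "vec.span (rows M)"])
      (auto intro: vec.span_base)
  have "c i = 0" if c: "(\<Sum>i\<in>UNIV. c i *s row i M) = 0" for c i
  proof -
    define u where "u x = c (inv (\<lambda>i. row i M) x)" for x
    have "(\<Sum>x\<in>rows M. u x *s x) = (\<Sum>i\<in>UNIV. u (row i M) *s row i M)"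
      unfolding rows by (subst sum.reindex[OF inj]) simp
    also have "\<dots> = 0" using c by (simp add: u_def inv_f_f[OF inj])
    finally have "u (row i M) = 0"
      using ind fin unfolding vec.independent_explicit_module
      by (elim allE[of _ "rows M"] allE[of _ u] allE[of _ "row i M"]) (auto simp: rows)
    then show ?thesis by (simp add: u_def inv_f_f[OF inj])
  qed
  then have "\<exists>B. M ** B = mat 1" unfolding matrix_right_invertible_independent_rows by blast
  then show ?thesis unfolding matrix_right_invertible_surjective .
qed

lemma full_rank_off_invariant_zeros:
  fixes A :: "real^'n^'n" and B :: "real^'m^'n" and C :: "real^'n^'p" and D :: "real^'m^'p"
  assumes "right_invertible A B C D" "z \<notin> invariant_zeros A B C D"
  shows "rank (eval_pmat (system_pencil A B C D) z) = CARD('n) + CARD('p)"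
proof -
  let ?R = "\<lambda>z. rank (eval_pmat (system_pencil A B C D) z)"
  have le: "?R z \<le> CARD('n) + CARD('p)" for z
    using rank_le_rows[of "eval_pmat (system_pencil A B C D) z"] by simp
  have "infinite (UNIV :: complex set)" by (rule infinite_UNIV_char_0)
  then obtain z0 where "?R z0 = CARD('n) + CARD('p)"
    using assms(1) unfolding right_invertible_def by (metis (mono_tags) ex_new_if_finite mem_Collect_eq)
  then have "CARD('n) + CARD('p) \<le> normal_rank (system_pencil A B C D)"
    unfolding normal_rank_def using le
    by (intro Max_ge) (auto intro: finite_subset[of _ "{..CARD('n) + CARD('p)}"] simp: image_iff eq_commute)
  then show ?thesis using assms(2) le[of z] by (auto simp: invariant_zeros_def)
qed

lemma pencil_surj_off_invariant_zeros:
  fixes A :: "real^'n^'n" and B :: "real^'m^'n" and C :: "real^'n^'p" and D :: "real^'m^'p"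
  assumes "right_invertible A B C D" "complex_of_real s \<notin> invariant_zeros A B C D"
  obtains v w where "(A - mat s) *v v + B *v w = a" "C *v v + D *v w = b"
proof -
  let ?P = "eval_pmat (system_pencil A B C D) (complex_of_real s)"
  have "rank ?P = CARD('n + 'p)" using full_rank_off_invariant_zeros[OF assms] by simp
  then have "surj ((*v) ?P)" by (rule surj_if_rank_eq_rows)
  then obtain x where x: "?P *v x = (\<chi> r. case r of Inl i \<Rightarrow> complex_of_real (a $ i) | Inr i \<Rightarrow> complex_of_real (b $ i))"
    by (metis surjD)
  define v where "v = (\<chi> j. Re (x $ Inl j))"
  define w where "w = (\<chi> j. Re (x $ Inr j))"
  have split: "(?P *v x) $ r = (\<Sum>j\<in>UNIV. ?P $ r $ Inl j * x $ Inl j) + (\<Sum>j\<in>UNIV. ?P $ r $ Inr j * x $ Inr j)" for r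
    unfolding matrix_vector_mult_def by (simp flip: UNIV_Plus_UNIV add: sum.Plus)
  have "((A - mat s) *v v + B *v w) $ i = a $ i" for i
  proof -
    have "a $ i = Re ((?P *v x) $ Inl i)" by (simp add: x)
    also have "\<dots> = (\<Sum>j\<in>UNIV. (A $ i $ j - (if i = j then s else 0)) * v $ j) + (\<Sum>j\<in>UNIV. B $ i $ j * w $ j)"
      unfolding split by (auto simp: eval_pmat_def system_pencil_def v_def w_def intro!: sum.cong)
    also have "\<dots> = ((A - mat s) *v v + B *v w) $ i"
      by (simp add: matrix_vector_mult_def mat_def)
    finally show ?thesis by simp
  qed
  moreover have "(C *v v + D *v w) $ i = b $ i" for i
  proof -
    have "b $ i = Re ((?P *v x) $ Inr i)" by (simp add: x)
    also have "\<dots> = (C *v v + D *v w) $ i"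
      unfolding split by (auto simp: eval_pmat_def system_pencil_def v_def w_def matrix_vector_mult_def)
    finally show ?thesis by simp
  qed
  ultimately show ?thesis using that[of v w] by (simp add: vec_eq_iff)
qed

lemma invertible_matrix_inv:
  fixes X :: "'a::semiring_1^'n^'m"
  assumes "invertible X"
  shows "X ** matrix_inv X = mat 1" "matrix_inv X ** X = mat 1"
  using someI_ex[OF assms[unfolded invertible_def]] by (auto simp: matrix_inv_def)

lemma map_matrix_of_real_mult:
  "map_matrix complex_of_real (P ** Q) = map_matrix complex_of_real P ** map_matrix complex_of_real Q"
  by (simp add: vec_eq_iff matrix_matrix_mult_def)

lemma linear_ode_unique:
  fixes z :: "real \<Rightarrow> real"
  assumes "\<And>t. t \<ge> 0 \<Longrightarrow> (z has_real_derivative a * z t) (at t within {0..})" "t \<ge> 0"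
  shows "z t = exp (a * t) * z 0"
proof -
  have der: "((\<lambda>t. z t * exp (- a * t)) has_real_derivative 0) (at t within {0..})" if "t \<in> {0..}" for t
    using assms(1)[of t] that by (auto intro!: derivative_eq_intros)
  have "\<exists>c. \<forall>t\<in>{0..}. z t * exp (- a * t) = c"
    by (rule has_field_derivative_zero_constant[OF _ der]) simp_all
  then obtain c where c: "\<And>t. t \<in> {0..} \<Longrightarrow> z t * exp (- a * t) = c" by blast
  have "z t * exp (- a * t) = z 0" using c[of t] c[of 0] assms(2) by simp
  then show ?thesis by (simp add: exp_minus field_simps)
qed

locale diagonalized =
  fixes M X :: "real^'n^'n" and \<mu> :: "'n \<Rightarrow> real"
  assumes inv: "invertible X"
    and eig: "M *v column c X = \<mu> c *\<^sub>R column c X"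
begin

definition coord :: "real^'n \<Rightarrow> real^'n" where "coord x = matrix_inv X *v x"

lemma coord_inverse [simp]: "X *v coord x = x" "coord (X *v z) = z"
  by (simp_all add: coord_def matrix_vector_mul_assoc invertible_matrix_inv[OF inv])

lemma mult_basis: "M *v (X *v z) = X *v (\<chi> c. \<mu> c * z $ c)"
proof -
  have "M *v (X *v z) = (\<Sum>c\<in>UNIV. z $ c *\<^sub>R (M *v column c X))"
    by (simp add: matrix_mult_sum[of X] scalar_mult_eq_scaleR linear_sum[OF matrix_vector_mul_linear]
        linear_cmul[OF matrix_vector_mul_linear])
  then show ?thesis by (simp add: eig matrix_mult_sum[of X] scalar_mult_eq_scaleR mult.commute)
qed

lemma coord_mult: "coord (M *v x) $ c = \<mu> c * coord x $ c"
  using mult_basis[of "coord x"] by simp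

lemma invertible_if_nonzero:
  assumes "\<And>c. \<mu> c \<noteq> 0"
  shows "invertible M"
  unfolding invertible_left_inverse matrix_left_invertible_ker
proof (intro allI impI)
  fix x assume "M *v x = 0"
  then have "\<mu> c * coord x $ c = 0" for c using coord_mult[of x c] by (simp add: coord_def)
  then have "coord x = 0" using assms by (simp add: vec_eq_iff)
  then show "x = 0" using coord_inverse(1)[of x] by simp
qed

lemma spectrum_subset: "spectrum M \<subseteq> range (\<lambda>c. complex_of_real (\<mu> c))"
proof
  fix z assume "z \<in> spectrum M"
  let ?c = "map_matrix complex_of_real"
  obtain v where v: "v \<noteq> 0" "?c M *v v = z *s v"
    using \<open>z \<in> spectrum M\<close> by (auto simp: spectrum_def map_matrix_def)
  define y where "y = ?c (matrix_inv X) *v v"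
  define L where "L = (\<chi> i j. if i = j then \<mu> i else 0)"
  have L: "(L *v u) $ c = \<mu> c * u $ c" for u c
    by (simp add: L_def matrix_vector_mult_def if_distrib if_distribR cong: if_cong)
  have "(matrix_inv X ** M) *v u = (L ** matrix_inv X) *v u" for u
    using coord_mult[of u] by (simp add: vec_eq_iff L coord_def flip: matrix_vector_mul_assoc)
  then have "matrix_inv X ** M = L ** matrix_inv X" by (simp add: matrix_eq)
  then have "?c (matrix_inv X) *v (?c M *v v) = ?c L *v y"
    unfolding y_def by (simp add: matrix_vector_mul_assoc flip: map_matrix_of_real_mult)
  then have "z *s y = ?c L *v y" by (simp add: v y_def vector_scalar_commute)
  moreover have "(?c L *v y) $ c = of_real (\<mu> c) * y $ c" for c
    by (simp add: L_def matrix_vector_mult_def if_distrib if_distribR cong: if_cong)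
  ultimately have zy: "z * y $ c = of_real (\<mu> c) * y $ c" for c by (metis vector_smult_component)
  have one: "?c (mat 1 :: real^'n^'n) = mat 1" by (simp add: vec_eq_iff mat_def)
  then have "?c X *v y = v"
    by (simp add: y_def matrix_vector_mul_assoc invertible_matrix_inv[OF inv] one flip: map_matrix_of_real_mult)
  then have "y \<noteq> 0" using v(1) by auto
  then obtain c where "y $ c \<noteq> 0" by (auto simp: vec_eq_iff)
  then show "z \<in> range (\<lambda>c. complex_of_real (\<mu> c))" using zy[of c] by auto
qed

definition ct_flow :: "real^'n \<Rightarrow> real \<Rightarrow> real^'n" where
  "ct_flow z t = X *v (\<chi> c. exp (\<mu> c * t) * z $ c)"

definition dt_flow :: "real^'n \<Rightarrow> nat \<Rightarrow> real^'n" where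
  "dt_flow z t = X *v (\<chi> c. \<mu> c ^ t * z $ c)"

lemma ct_flow_trajectory: "(ct_flow z has_vector_derivative M *v ct_flow z t) (at t within S)"
proof -
  have "((\<lambda>t. \<Sum>c\<in>UNIV. (exp (\<mu> c * t) * z $ c) *\<^sub>R column c X) has_vector_derivative
     (\<Sum>c\<in>UNIV. (\<mu> c * (exp (\<mu> c * t) * z $ c)) *\<^sub>R column c X)) (at t within S)"
    by (intro has_vector_derivative_sum)
      (auto intro!: derivative_eq_intros simp: has_vector_derivative_def mult_ac)
  then show ?thesis
    unfolding ct_flow_def mult_basis by (simp add: matrix_mult_sum scalar_mult_eq_scaleR)
qed

lemma ct_trajectory_is_flow:
  assumes "\<And>t. t \<ge> 0 \<Longrightarrow> (\<xi> has_vector_derivative M *v \<xi> t) (at t within {0..})" "t \<ge> 0"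
  shows "\<xi> t = ct_flow (coord (\<xi> 0)) t"
proof -
  have "coord (\<xi> t) $ c = exp (\<mu> c * t) * coord (\<xi> 0) $ c" for c
  proof (rule linear_ode_unique[OF _ assms(2)])
    fix t :: real assume "t \<ge> 0"
    have "bounded_linear (\<lambda>x. coord x $ c)"
      unfolding coord_def by (intro bounded_linear_compose[OF bounded_linear_vec_nth] matrix_vector_mul_bounded_linear)
    from bounded_linear.has_vector_derivative[OF this assms(1)[OF \<open>t \<ge> 0\<close>]]
    show "((\<lambda>t. coord (\<xi> t) $ c) has_real_derivative \<mu> c * coord (\<xi> t) $ c) (at t within {0..})"
      by (simp add: coord_mult has_real_derivative_iff_has_vector_derivative)
  qed
  then have "coord (\<xi> t) = (\<chi> c. exp (\<mu> c * t) * coord (\<xi> 0) $ c)" by (simp add: vec_eq_iff)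
  then show ?thesis unfolding ct_flow_def by (metis coord_inverse(1))
qed

lemma dt_flow_trajectory: "dt_flow z (Suc t) = M *v dt_flow z t"
  by (simp add: dt_flow_def mult_basis mult_ac)

lemma dt_trajectory_is_flow:
  assumes "\<And>t. \<xi> (Suc t) = M *v \<xi> t"
  shows "\<xi> t = dt_flow (coord (\<xi> 0)) t"
  by (induction t) (simp_all add: dt_flow_def assms mult_basis mult_ac)

lemma ct_flow_tendsto_0:
  assumes "\<And>c. \<mu> c < 0"
  shows "(ct_flow z \<longlongrightarrow> 0) at_top"
proof -
  have "((\<lambda>t. exp (\<mu> c * t) * z $ c) \<longlongrightarrow> 0) at_top" for c
  proof -
    have "filterlim (\<lambda>t. \<mu> c * t) at_bot at_top"
      using assms[of c] by (simp add: filterlim_tendsto_neg_mult_at_bot[OF tendsto_const _ filterlim_ident])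
    then have "((\<lambda>t. exp (\<mu> c * t)) \<longlongrightarrow> 0) at_top" by (rule filterlim_compose[OF exp_at_bot])
    then show ?thesis by (rule tendsto_mult_left_zero)
  qed
  then have "((\<lambda>t. \<chi> c. exp (\<mu> c * t) * z $ c) \<longlongrightarrow> 0) at_top"
    by (intro vec_tendstoI) simp
  from bounded_linear.tendsto[OF matrix_vector_mul_bounded_linear this, of X]
  show ?thesis by (simp add: ct_flow_def[abs_def])
qed

lemma dt_flow_tendsto_0:
  assumes "\<And>c. \<bar>\<mu> c\<bar> < 1"
  shows "dt_flow z \<longlonglongrightarrow> 0"
proof -
  have "(\<lambda>t. \<mu> c ^ t * z $ c) \<longlonglongrightarrow> 0" for c
    using assms[of c] by (intro tendsto_mult_left_zero LIMSEQ_power_zero) simp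
  then have "(\<lambda>t. \<chi> c. \<mu> c ^ t * z $ c) \<longlonglongrightarrow> 0"
    by (intro vec_tendstoI) simp
  from bounded_linear.tendsto[OF matrix_vector_mul_bounded_linear this, of X]
  show ?thesis by (simp add: dt_flow_def[abs_def])
qed

end

lemma mat_mult_vector: "(mat s :: real^'n^'n) *v v = s *\<^sub>R v"
  by (simp add: vec_eq_iff matrix_vector_mult_def mat_def if_distrib if_distribR cong: if_cong)

lemma right_inverse_static_gain_exists:
  fixes A :: "real^'n^'n" and B :: "real^'m^'n" and C :: "real^'n^'p" and D :: "real^'m^'p"
    and F :: "real^'n^'m"
  assumes "right_invertible A B C D" "steady_state_point td \<notin> invariant_zeros A B C D"
    and inv: "case td of Continuous \<Rightarrow> invertible (A + B ** F) | Discrete \<Rightarrow> invertible (mat 1 - (A + B ** F))"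
  shows "\<exists>G :: real^'p^'m. static_gain td (A + B ** F) B (C + D ** F) D ** G = mat 1"
  unfolding matrix_right_invertible_surjective
proof (intro surjI)
  define s :: real where "s = (case td of Continuous \<Rightarrow> 0 | Discrete \<Rightarrow> 1)"
  have s: "complex_of_real s \<notin> invariant_zeros A B C D"
    using assms(2) by (cases td) (simp_all add: s_def)
  fix b
  let ?K = "static_gain td (A + B ** F) B (C + D ** F) D"
  have "\<exists>w. ?K *v w = b"
  proof -
    obtain v w where vw: "(A - mat s) *v v + B *v w = 0" "C *v v + D *v w = b"
      using pencil_surj_off_invariant_zeros[OF assms(1) s] .
    define u where "u = w - F *v v"
    have state: "(A + B ** F) *v v + B *v u = s *\<^sub>R v"
      using vw(1)
      by (simp add: u_def algebra_simps matrix_vector_mul_assoc mat_mult_vector)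
    have out: "(C + D ** F) *v v + D *v u = b"
      using vw(2) by (simp add: u_def algebra_simps matrix_vector_mul_assoc)
    have "?K *v u = b"
    proof (cases td)
      case Continuous
      define Mi where "Mi = matrix_inv (A + B ** F)"
      have "Mi ** (A + B ** F) = mat 1"
        using inv Continuous unfolding Mi_def by (intro invertible_matrix_inv) simp
      then have "Mi *v ((A + B ** F) *v y) = y" for y by (simp only: matrix_vector_mul_assoc matrix_vector_mul_lid)
      moreover have "B *v u = - ((A + B ** F) *v v)"
        using state Continuous by (simp add: s_def add_eq_0_iff)
      ultimately have "Mi *v (B *v u) = - v"
        by (simp add: linear_neg[OF matrix_vector_mul_linear])
      then show ?thesis using out Continuous
        by (simp add: matrix_vector_mult_diff_rdistrib Mi_def[symmetric] linear_neg[OF matrix_vector_mul_linear]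
            add.commute flip: matrix_vector_mul_assoc)
    next
      case Discrete
      define Mi where "Mi = matrix_inv (mat 1 - (A + B ** F))"
      have "Mi ** (mat 1 - (A + B ** F)) = mat 1"
        using inv Discrete unfolding Mi_def by (intro invertible_matrix_inv) simp
      moreover have "B *v u = (mat 1 - (A + B ** F)) *v v"
        using state Discrete by (simp add: s_def matrix_vector_mult_diff_rdistrib algebra_simps)
      ultimately have "Mi *v (B *v u) = v"
        by (simp only: matrix_vector_mul_assoc matrix_vector_mul_lid)
      then show ?thesis using out Discrete
        by (simp add: matrix_vector_mult_add_rdistrib Mi_def[symmetric] add.commute
            flip: matrix_vector_mul_assoc)
    qed
    then show ?thesis by blast
  qed
  then show "?K *v (SOME w. ?K *v w = b) = b" by (rule someI_ex)
qed

locale decoupled_closed_loop = diagonalized "A + B ** F" X "\<lambda>c. case_prod lam (\<phi> c)"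
  for A :: "real^'n^'n" and B :: "real^'m^'n" and F :: "real^'n^'m" and X :: "real^'n^'n"
    and lam :: "'p::finite option \<Rightarrow> nat \<Rightarrow> real" and \<phi> :: "'n \<Rightarrow> 'p option \<times> nat" +
  fixes C :: "real^'n^'p" and D :: "real^'m^'p" and \<nu> :: "'p option \<Rightarrow> nat" and \<gamma> :: "'n \<Rightarrow> real"
    and td :: time_domain
  assumes col_order: "bij_betw \<phi> UNIV (eig_index \<nu>)"
    and stable: "case_prod lam (\<phi> c) \<in> real_stability_region td"
    and unobservable: "\<phi> c = (None, j) \<Longrightarrow> (C + D ** F) *v column c X = 0"
    and observable: "\<phi> c = (Some i, j) \<Longrightarrow> (C + D ** F) *v column c X = \<gamma> c *\<^sub>R axis i 1"
    and gain_nonzero: "\<phi> c = (Some i, j) \<Longrightarrow> \<gamma> c \<noteq> 0"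
begin

abbreviation "M \<equiv> A + B ** F"
abbreviation "K \<equiv> C + D ** F"
abbreviation "\<mu> \<equiv> \<lambda>c. case_prod lam (\<phi> c)"

definition \<psi> :: "'p option \<times> nat \<Rightarrow> 'n" where "\<psi> = the_inv_into UNIV \<phi>"

lemma \<psi>_\<phi> [simp]: "\<psi> (\<phi> c) = c"
  unfolding \<psi>_def using col_order by (intro the_inv_into_f_f) (auto simp: bij_betw_def)

lemma \<phi>_\<psi>: "q \<in> eig_index \<nu> \<Longrightarrow> \<phi> (\<psi> q) = q"
  unfolding \<psi>_def using col_order by (intro f_the_inv_into_f) (auto simp: bij_betw_def)

lemma \<phi>_in: "\<phi> c \<in> eig_index \<nu>" using col_order by (auto simp: bij_betw_def)

lemma \<psi>_image: "\<psi> ` eig_index \<nu> = UNIV" by (metis \<phi>_in \<psi>_\<phi> rangeI image_eqI UNIV_eq_I)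

lemma output_mode:
  "(K *v (X *v (\<chi> c. s c))) $ i = (\<Sum>j = 1..\<nu> (Some i). \<gamma> (\<psi> (Some i, j)) * s (\<psi> (Some i, j)))"
proof -
  have bij: "bij_betw (\<lambda>j. \<psi> (Some i, j)) {1..\<nu> (Some i)} {c. fst (\<phi> c) = Some i}"
  proof (rule bij_betw_byWitness[where f' = "\<lambda>c. snd (\<phi> c)"])
    show "(\<lambda>c. snd (\<phi> c)) ` {c. fst (\<phi> c) = Some i} \<subseteq> {1..\<nu> (Some i)}"
    proof (intro image_subsetI)
      fix c assume "c \<in> {c. fst (\<phi> c) = Some i}"
      then show "snd (\<phi> c) \<in> {1..\<nu> (Some i)}" using \<phi>_in[of c] by (auto simp: eig_index_def)
    qed
    show "\<forall>c\<in>{c. fst (\<phi> c) = Some i}. \<psi> (Some i, snd (\<phi> c)) = c"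
      by (metis (mono_tags) \<psi>_\<phi> mem_Collect_eq prod.collapse)
  qed (auto simp: \<phi>_\<psi> eig_index_def)
  have "(K *v (X *v (\<chi> c. s c))) $ i = (\<Sum>c\<in>UNIV. s c * (K *v column c X) $ i)"
    by (simp add: matrix_mult_sum[of X] scalar_mult_eq_scaleR linear_sum[OF matrix_vector_mul_linear]
        linear_cmul[OF matrix_vector_mul_linear])
  also have "\<dots> = (\<Sum>c\<in>{c. fst (\<phi> c) = Some i}. s c * (K *v column c X) $ i)"
  proof (rule sum.mono_neutral_right)
    show "\<forall>c\<in>UNIV - {c. fst (\<phi> c) = Some i}. s c * (K *v column c X) $ i = 0"
    proof
      fix c assume c: "c \<in> UNIV - {c. fst (\<phi> c) = Some i}"
      obtain l j where \<phi>: "\<phi> c = (l, j)" by (cases "\<phi> c")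
      show "s c * (K *v column c X) $ i = 0"
        using c \<phi> unobservable[of c j] observable[of c _ j] by (cases l) (auto simp: axis_def)
    qed
  qed auto
  also have "\<dots> = (\<Sum>c\<in>{c. fst (\<phi> c) = Some i}. \<gamma> c * s c)"
  proof (rule sum.cong)
    fix c assume "c \<in> {c. fst (\<phi> c) = Some i}"
    then have "\<phi> c = (Some i, snd (\<phi> c))" by (metis mem_Collect_eq prod.collapse)
    from observable[OF this] show "s c * (K *v column c X) $ i = \<gamma> c * s c" by (simp add: axis_def)
  qed simp
  also have "\<dots> = (\<Sum>j = 1..\<nu> (Some i). \<gamma> (\<psi> (Some i, j)) * s (\<psi> (Some i, j)))"
    by (rule sum.reindex_bij_betw[OF bij, symmetric])
  finally show ?thesis .
qed

lemma \<mu>_\<psi>: "j \<in> {1..\<nu> (Some i)} \<Longrightarrow> \<mu> (\<psi> (Some i, j)) = lam (Some i) j"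
  by (simp add: \<phi>_\<psi> eig_index_def)

lemma output_ct_flow:
  "(K *v ct_flow z t) $ i =
     (\<Sum>j = 1..\<nu> (Some i). \<gamma> (\<psi> (Some i, j)) * z $ \<psi> (Some i, j) * exp (lam (Some i) j * t))"
  unfolding ct_flow_def output_mode by (intro sum.cong) (simp_all add: \<mu>_\<psi>)

lemma output_dt_flow:
  "(K *v dt_flow z t) $ i =
     (\<Sum>j = 1..\<nu> (Some i). \<gamma> (\<psi> (Some i, j)) * z $ \<psi> (Some i, j) * lam (Some i) j ^ t)"
  unfolding dt_flow_def output_mode by (intro sum.cong) (simp_all add: \<mu>_\<psi>)

definition mode_state :: "('p \<Rightarrow> nat \<Rightarrow> real) \<Rightarrow> real^'n" where
  "mode_state \<beta> = (\<chi> c. case \<phi> c of (None, j) \<Rightarrow> 0 | (Some i, j) \<Rightarrow> \<beta> i j / \<gamma> c)"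

lemma mode_state:
  "j \<in> {1..\<nu> (Some i)} \<Longrightarrow> \<gamma> (\<psi> (Some i, j)) * mode_state \<beta> $ \<psi> (Some i, j) = \<beta> i j"
  using gain_nonzero[of "\<psi> (Some i, j)" i j] by (simp add: mode_state_def \<phi>_\<psi> eig_index_def)

lemma error_decoupled: "error_decoupled td A B C D \<nu> lam F"
proof (cases td)
  case Continuous
  have "\<exists>\<beta>. \<forall>t\<ge>0. \<forall>i. (K *v \<xi> t) $ i = (\<Sum>j = 1..\<nu> (Some i). \<beta> i j * exp (lam (Some i) j * t))"
    if "\<forall>t\<ge>0. (\<xi> has_vector_derivative M *v \<xi> t) (at t within {0..})" for \<xi>
  proof (intro exI allI impI)
    fix t :: real and i assume "0 \<le> t"
    with that have flow: "\<xi> t = ct_flow (coord (\<xi> 0)) t" by (intro ct_trajectory_is_flow) auto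
    show "(K *v \<xi> t) $ i = (\<Sum>j = 1..\<nu> (Some i). \<gamma> (\<psi> (Some i, j)) * coord (\<xi> 0) $ \<psi> (Some i, j) * exp (lam (Some i) j * t))"
      unfolding flow by (rule output_ct_flow)
  qed
  moreover have "\<exists>\<xi>. (\<forall>t\<ge>0. (\<xi> has_vector_derivative M *v \<xi> t) (at t within {0..})) \<and>
      (\<forall>t\<ge>0. \<forall>i. (K *v \<xi> t) $ i = (\<Sum>j = 1..\<nu> (Some i). \<beta> i j * exp (lam (Some i) j * t)))" for \<beta>
    by (intro exI[of _ "ct_flow (mode_state \<beta>)"])
      (simp add: ct_flow_trajectory output_ct_flow mode_state)
  ultimately show ?thesis unfolding Continuous error_decoupled.simps Let_def by blast
next
  case Discrete
  have "\<exists>\<beta>. \<forall>t i. (K *v \<xi> t) $ i = (\<Sum>j = 1..\<nu> (Some i). \<beta> i j * lam (Some i) j ^ t)"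
    if "\<forall>t. \<xi> (Suc t) = M *v \<xi> t" for \<xi>
  proof (intro exI allI)
    fix t i
    from that have flow: "\<xi> t = dt_flow (coord (\<xi> 0)) t" by (intro dt_trajectory_is_flow) auto
    show "(K *v \<xi> t) $ i = (\<Sum>j = 1..\<nu> (Some i). \<gamma> (\<psi> (Some i, j)) * coord (\<xi> 0) $ \<psi> (Some i, j) * lam (Some i) j ^ t)"
      unfolding flow by (rule output_dt_flow)
  qed
  moreover have "\<exists>\<xi>. (\<forall>t. \<xi> (Suc t) = M *v \<xi> t) \<and>
      (\<forall>t i. (K *v \<xi> t) $ i = (\<Sum>j = 1..\<nu> (Some i). \<beta> i j * lam (Some i) j ^ t))" for \<beta>
    by (intro exI[of _ "dt_flow (mode_state \<beta>)"])
      (simp add: dt_flow_trajectory output_dt_flow mode_state)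
  ultimately show ?thesis unfolding Discrete error_decoupled.simps Let_def by blast
qed

lemma eigenstructure_assigned: "eigenstructure_assigned A B C D \<nu> lam F"
  unfolding eigenstructure_assigned_def
proof (intro exI conjI)
  let ?v = "\<lambda>q. column (\<psi> q) X"
  have "?v ` eig_index \<nu> = (\<lambda>c. column c X) ` \<psi> ` eig_index \<nu>" by auto
  then have img: "?v ` eig_index \<nu> = columns X" unfolding \<psi>_image by (auto simp: columns_def)
  have fin: "finite (eig_index \<nu>)" and card: "card (eig_index \<nu>) = CARD('n)"
    using col_order bij_betw_finite bij_betw_same_card by fastforce+
  show span: "span (?v ` eig_index \<nu>) = UNIV"
    using inv unfolding img invertible_right_inverse matrix_right_invertible_span_columns
    by (simp add: span_vec_eq)
  have "inj_on ?v (eig_index \<nu>) \<and> independent (?v ` eig_index \<nu>)"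
  proof (rule independent_image_if_card_le_dim[OF fin])
    show "card (eig_index \<nu>) \<le> dim (?v ` eig_index \<nu>)"
      using dim_span[of "?v ` eig_index \<nu>"] card unfolding span by simp
  qed
  then show "inj_on ?v (eig_index \<nu>)" "independent (?v ` eig_index \<nu>)" by blast+
  show "\<forall>(i, j)\<in>eig_index \<nu>. M *v ?v (i, j) = lam i j *\<^sub>R ?v (i, j)"
    using eig \<phi>_\<psi> by fastforce
  show "\<forall>j\<in>{1..\<nu> None}. K *v ?v (None, j) = 0"
    using unobservable \<phi>_\<psi> by (auto simp: eig_index_def)
  show "\<forall>i. \<forall>j\<in>{1..\<nu> (Some i)}. \<exists>c. c \<noteq> 0 \<and> K *v ?v (Some i, j) = c *\<^sub>R axis i 1"
  proof (intro allI ballI)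
    fix i j assume "j \<in> {1..\<nu> (Some i)}"
    then have "\<phi> (\<psi> (Some i, j)) = (Some i, j)" by (intro \<phi>_\<psi>) (simp add: eig_index_def)
    then show "\<exists>c. c \<noteq> 0 \<and> K *v ?v (Some i, j) = c *\<^sub>R axis i 1"
      using observable gain_nonzero by blast
  qed
qed

lemma spectrum_stable: "spectrum M \<subseteq> stability_region td"
  using spectrum_subset stable by (fastforce simp: real_stability_region_def)

lemma stable_Continuous: "td = Continuous \<Longrightarrow> \<mu> c < 0"
  using stable[of c] by (simp add: real_stability_region_def)

lemma stable_Discrete: "td = Discrete \<Longrightarrow> \<bar>\<mu> c\<bar> < 1"
  using stable[of c] by (simp add: real_stability_region_def)

lemma closed_loop_invertible:
  "case td of Continuous \<Rightarrow> invertible M | Discrete \<Rightarrow> invertible (mat 1 - M)"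
proof (cases td)
  case Continuous
  have "\<mu> c \<noteq> 0" for c using stable_Continuous[OF Continuous, of c] by auto
  from invertible_if_nonzero[OF this] show ?thesis by (simp add: Continuous)
next
  case Discrete
  interpret one: diagonalized "mat 1 - M" X "\<lambda>c. 1 - \<mu> c"
    by unfold_locales (simp_all only: inv matrix_vector_mult_diff_rdistrib eig
        matrix_vector_mul_lid scaleR_left_diff_distrib scaleR_one)
  have "1 - \<mu> c \<noteq> 0" for c using stable_Discrete[OF Discrete, of c] by auto
  from one.invertible_if_nonzero[OF this] show ?thesis by (simp add: Discrete)
qed

lemma tracks_constants:
  fixes G :: "real^'p^'m"
  assumes G: "static_gain td M B K D ** G = mat 1"
  shows "tracks_constants td A B C D F G"
proof (cases td)
  case Continuous
  define Mi where "Mi = matrix_inv M"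
  have Mi: "M ** Mi = mat 1"
    unfolding Mi_def using closed_loop_invertible Continuous by (intro invertible_matrix_inv) simp
  show ?thesis unfolding Continuous tracks_constants.simps
  proof (intro allI impI)
    fix r x u
    assume u: "\<forall>t\<ge>0. u t = F *v x t + G *v r"
      and x: "\<forall>t\<ge>0. (x has_vector_derivative A *v x t + B *v u t) (at t within {0..})"
    define xs where "xs = - (Mi *v (B *v (G *v r)))"
    have Mxs: "M *v xs = - (B *v (G *v r))"
      unfolding xs_def linear_neg[OF matrix_vector_mul_linear] matrix_vector_mul_assoc[of M] Mi by simp
    have der: "((\<lambda>t. x t - xs) has_vector_derivative M *v (x t - xs)) (at t within {0..})" if "t \<ge> 0" for t
    proof -
      have "M *v (x t - xs) = A *v x t + B *v u t"
        using u that unfolding matrix_vector_mult_diff_distrib Mxs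
        by (simp add: algebra_simps matrix_vector_mul_assoc)
      then show ?thesis using x that by (auto intro!: derivative_eq_intros)
    qed
    have "((\<lambda>t. K *v ct_flow (coord (x 0 - xs)) t) \<longlongrightarrow> K *v 0) at_top"
      by (intro bounded_linear.tendsto[OF matrix_vector_mul_bounded_linear] ct_flow_tendsto_0
          stable_Continuous Continuous)
    then have "((\<lambda>t. K *v ct_flow (coord (x 0 - xs)) t + r) \<longlongrightarrow> r) at_top"
      by (auto intro: tendsto_eq_intros)
    moreover have "\<forall>\<^sub>F t in at_top. K *v ct_flow (coord (x 0 - xs)) t + r = C *v x t + D *v u t"
    proof (rule eventually_at_top_linorderI)
      fix t :: real assume t: "0 \<le> t"
      have "r = (static_gain td M B K D ** G) *v r" by (simp add: G)
      also have "\<dots> = K *v xs + D *v (G *v r)"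
        by (simp add: Continuous xs_def Mi_def matrix_vector_mult_diff_rdistrib
            linear_neg[OF matrix_vector_mul_linear] flip: matrix_vector_mul_assoc)
      finally have r: "r = K *v xs + D *v (G *v r)" .
      have "C *v x t + D *v u t = K *v x t + D *v (G *v r)"
        using u t by (simp add: algebra_simps matrix_vector_mul_assoc)
      also have "\<dots> = K *v (x t - xs) + r"
        by (subst (2) r) (simp add: matrix_vector_mult_diff_distrib)
      also have "x t - xs = ct_flow (coord (x 0 - xs)) t"
        by (rule ct_trajectory_is_flow[OF der t])
      finally show "K *v ct_flow (coord (x 0 - xs)) t + r = C *v x t + D *v u t" ..
    qed
    ultimately show "((\<lambda>t. C *v x t + D *v u t) \<longlongrightarrow> r) at_top" by (rule Lim_transform_eventually)
  qed
next
  case Discrete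
  define Mi where "Mi = matrix_inv (mat 1 - M)"
  have Mi: "(mat 1 - M) ** Mi = mat 1"
    unfolding Mi_def using closed_loop_invertible Discrete by (intro invertible_matrix_inv) simp
  show ?thesis unfolding Discrete tracks_constants.simps
  proof (intro allI impI)
    fix r x u
    assume u: "\<forall>t. u t = F *v x t + G *v r" and x: "\<forall>t. x (Suc t) = A *v x t + B *v u t"
    define xs where "xs = Mi *v (B *v (G *v r))"
    have "(mat 1 - M) *v xs = B *v (G *v r)"
      unfolding xs_def matrix_vector_mul_assoc[of "mat 1 - M"] Mi by simp
    then have Mxs: "M *v xs = xs - B *v (G *v r)"
      by (simp add: matrix_vector_mult_diff_rdistrib algebra_simps)
    have step: "x (Suc t) - xs = M *v (x t - xs)" for t
      using u x unfolding matrix_vector_mult_diff_distrib Mxs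
      by (simp add: algebra_simps matrix_vector_mul_assoc)
    have "(\<lambda>t. K *v dt_flow (coord (x 0 - xs)) t) \<longlonglongrightarrow> K *v 0"
      by (intro bounded_linear.tendsto[OF matrix_vector_mul_bounded_linear] dt_flow_tendsto_0
          stable_Discrete Discrete)
    then have "(\<lambda>t. K *v dt_flow (coord (x 0 - xs)) t + r) \<longlonglongrightarrow> r"
      by (auto intro: tendsto_eq_intros)
    moreover have "K *v dt_flow (coord (x 0 - xs)) t + r = C *v x t + D *v u t" for t
    proof -
      have "r = (static_gain td M B K D ** G) *v r" by (simp add: G)
      also have "\<dots> = K *v xs + D *v (G *v r)"
        by (simp add: Discrete xs_def Mi_def matrix_vector_mult_add_rdistrib
            flip: matrix_vector_mul_assoc)
      finally have r: "r = K *v xs + D *v (G *v r)" .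
      have "C *v x t + D *v u t = K *v x t + D *v (G *v r)"
        using u by (simp add: algebra_simps matrix_vector_mul_assoc)
      also have "\<dots> = K *v (x t - xs) + r"
        by (subst (2) r) (simp add: matrix_vector_mult_diff_distrib)
      also have "x t - xs = dt_flow (coord (x 0 - xs)) t"
        by (rule dt_trajectory_is_flow[of "\<lambda>t. x t - xs", OF step])
      finally show ?thesis ..
    qed
    ultimately show "(\<lambda>t. C *v x t + D *v u t) \<longlonglongrightarrow> r" by simp
  qed
qed

end

lemma finite_param_index: "finite {(i :: 'p::finite option, j :: nat, l :: nat). j \<in> {1..\<nu> i} \<and> l \<in> {1..d i j}}"
proof (rule finite_subset)
  show "{(i, j, l). j \<in> {1..\<nu> i} \<and> l \<in> {1..d i j}} \<subseteq> (SIGMA i:UNIV. SIGMA j:{1..\<nu> i}. {1..d i j})"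
    by auto
qed auto

lemma span_indexed_family:
  fixes b :: "nat \<Rightarrow> 'a::real_vector"
  assumes "inj_on b {1..n}" "x \<in> span (b ` {1..n})"
  shows "\<exists>a. x = (\<Sum>l = 1..n. a l *\<^sub>R b l)"
proof -
  obtain u where "x = (\<Sum>v\<in>b ` {1..n}. u v *\<^sub>R v)" using assms(2) by (auto simp: span_finite)
  then have "x = (\<Sum>l = 1..n. u (b l) *\<^sub>R b l)" by (simp only: sum.reindex[OF assms(1)] o_def)
  then show ?thesis by (intro exI[of _ "\<lambda>l. u (b l)"])
qed

lemma real_polynomial_function_fun_upd:
  "real_polynomial_function (\<lambda>t. (k(q := t)) p)"
proof (cases "p = q")
  case True
  then show ?thesis by (simp add: real_polynomial_function.intros(1) bounded_linear_ident)
next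
  case False
  then show ?thesis by (simp add: real_polynomial_function.intros(2))
qed

lemma column_param_matrix:
  "\<phi> c = (i, j) \<Longrightarrow> column c (param_matrix \<phi> d b k) = (\<Sum>l = 1..d i j. k (i, j, l) *\<^sub>R b i j l)"
  by (simp add: param_matrix_def column_def vec_eq_iff)

lemma param_matrix_entry:
  "param_matrix \<phi> d b k $ r $ c =
     (\<Sum>l = 1..d (fst (\<phi> c)) (snd (\<phi> c)). k (fst (\<phi> c), snd (\<phi> c), l) * b (fst (\<phi> c)) (snd (\<phi> c)) l $ r)"
  by (simp add: param_matrix_def split_beta)

lemma det_param_matrix_polynomial:
  "real_polynomial_function (\<lambda>t. det (param_matrix \<phi> d b (k(q := t))))"
  unfolding det_def param_matrix_entry
  by (intro real_polynomial_function_sum real_polynomial_function_prod real_polynomial_function.intros(4)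
      real_polynomial_function.intros(2) real_polynomial_function_fun_upd finite_permutations) simp_all

lemma measurable_param:
  assumes "j \<in> {1..\<nu> i}" "l \<in> {1..d i j}"
  shows "(\<lambda>k. k (i, j, l)) \<in> borel_measurable (param_measure \<nu> d)"
proof -
  have "(\<lambda>k. k (i, j, l)) \<in> param_measure \<nu> d \<rightarrow>\<^sub>M (lborel :: real measure)"
    unfolding param_measure_def by (rule measurable_component_singleton) (use assms in auto)
  then show ?thesis by simp
qed

lemma det_param_matrix_measurable:
  assumes "\<And>c. \<phi> c \<in> eig_index \<nu>"
  shows "(\<lambda>k. det (param_matrix \<phi> d b k)) \<in> borel_measurable (param_measure \<nu> d)"
  unfolding det_def param_matrix_entry
proof (intro borel_measurable_sum borel_measurable_times borel_measurable_const borel_measurable_prod)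
  fix p r l assume l: "l \<in> {1..d (fst (\<phi> (p r))) (snd (\<phi> (p r)))}"
  have "snd (\<phi> (p r)) \<in> {1..\<nu> (fst (\<phi> (p r)))}" using assms[of "p r"] by (auto simp: eig_index_def)
  then show "(\<lambda>k. k (fst (\<phi> (p r)), snd (\<phi> (p r)), l)) \<in> borel_measurable (param_measure \<nu> d)"
    using l by (rule measurable_param)
qed

lemma AE_det_param_matrix:
  fixes \<phi> :: "'n::finite \<Rightarrow> 'p::finite option \<times> nat" and V :: "'p option \<Rightarrow> nat \<Rightarrow> nat \<Rightarrow> real^'n"
  assumes col_order: "bij_betw \<phi> UNIV (eig_index \<nu>)"
    and dims: "\<And>P. P \<subseteq> eig_index \<nu> \<Longrightarrow> card P \<le> dim (\<Union>(i, j)\<in>P. V i j ` {1..d i j})"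
  shows "AE k in param_measure \<nu> d. det (param_matrix \<phi> d V k) \<noteq> 0"
proof -
  let ?I = "{(i, j, l). j \<in> {1..\<nu> i} \<and> l \<in> {1..d i j}}"
  have fin: "finite (eig_index \<nu>)" and card: "card (eig_index \<nu>) = CARD('n)"
    using col_order bij_betw_finite bij_betw_same_card by fastforce+
  have in_index: "\<phi> c \<in> eig_index \<nu>" for c using col_order by (auto simp: bij_betw_def)
  obtain v where v: "\<And>q. q \<in> eig_index \<nu> \<Longrightarrow> v q \<in> (case q of (i, j) \<Rightarrow> V i j ` {1..d i j})"
    and ind: "inj_on v (eig_index \<nu>)" "independent (v ` eig_index \<nu>)"
  proof -
    have "\<exists>v. (\<forall>q\<in>eig_index \<nu>. v q \<in> (case q of (i, j) \<Rightarrow> V i j ` {1..d i j})) \<and>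
        inj_on v (eig_index \<nu>) \<and> independent (v ` eig_index \<nu>)"
      by (rule rado_independent_transversal[OF fin _ dims]) (auto split: prod.split)
    then show ?thesis using that by blast
  qed
  have "\<exists>L. \<forall>q\<in>eig_index \<nu>. L q \<in> {1..d (fst q) (snd q)} \<and> v q = V (fst q) (snd q) (L q)"
    using v by (intro bchoice) force
  then obtain L where L: "\<And>i j. (i, j) \<in> eig_index \<nu> \<Longrightarrow> L (i, j) \<in> {1..d i j} \<and> v (i, j) = V i j (L (i, j))"
    by force
  define k0 where "k0 = restrict (\<lambda>(i, j, l). if l = L (i, j) then 1 else 0 :: real) ?I"
  have "column c (param_matrix \<phi> d V k0) = v (\<phi> c)" for c
  proof -
    obtain i j where ij: "\<phi> c = (i, j)" by (cases "\<phi> c")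
    then have mem: "(i, j) \<in> eig_index \<nu>" using in_index[of c] by simp
    have "column c (param_matrix \<phi> d V k0) = (\<Sum>l = 1..d i j. (if l = L (i, j) then V i j l else 0))"
      unfolding column_param_matrix[of \<phi>, OF ij] using mem
      by (intro sum.cong) (auto simp: k0_def eig_index_def)
    then show ?thesis using L[OF mem] ij by simp
  qed
  then have "columns (param_matrix \<phi> d V k0) = v ` range \<phi>" by (auto simp: columns_def)
  also have "range \<phi> = eig_index \<nu>" using col_order by (simp add: bij_betw_def)
  finally have "rank (param_matrix \<phi> d V k0) = card (v ` eig_index \<nu>)"
    using ind(2) by (simp add: column_rank_def dim_eq_card_independent)
  then have "rank (param_matrix \<phi> d V k0) = CARD('n)" by (simp add: card_image[OF ind(1)] card)
  then have "det (param_matrix \<phi> d V k0) \<noteq> 0" by (simp add: det_eq_0_rank)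
  moreover have "k0 \<in> extensional ?I" by (simp add: k0_def)
  ultimately show ?thesis
    unfolding param_measure_def
    by (intro AE_nonzero_if_separately_polynomial finite_param_index det_param_matrix_polynomial
        det_param_matrix_measurable[unfolded param_measure_def] in_index)
qed

lemma AE_linear_form_nonzero:
  fixes a :: "nat \<Rightarrow> real"
  assumes "j \<in> {1..\<nu> i}" "\<exists>l\<in>{1..d i j}. a l \<noteq> 0"
  shows "AE k in param_measure \<nu> d. (\<Sum>l = 1..d i j. k (i :: 'p::finite option, j, l) * a l) \<noteq> 0"
proof -
  let ?I = "{(i, j, l). j \<in> {1..\<nu> i} \<and> l \<in> {1..d i j}}"
  obtain m where m: "m \<in> {1..d i j}" "a m \<noteq> 0" using assms(2) by blast
  define k0 where "k0 = restrict (\<lambda>q. if q = (i, j, m) then 1 else 0 :: real) ?I"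
  have "(\<Sum>l = 1..d i j. k0 (i, j, l) * a l) = (\<Sum>l = 1..d i j. if l = m then a l else 0)"
    using assms(1) by (intro sum.cong) (auto simp: k0_def)
  then have "(\<Sum>l = 1..d i j. k0 (i, j, l) * a l) \<noteq> 0" using m by simp
  moreover have "k0 \<in> extensional ?I" by (simp add: k0_def)
  moreover have "(\<lambda>k. \<Sum>l = 1..d i j. k (i, j, l) * a l) \<in> borel_measurable (\<Pi>\<^sub>M q\<in>?I. lborel)"
    using assms(1)
    by (intro borel_measurable_sum borel_measurable_times borel_measurable_const
        measurable_param[unfolded param_measure_def])
  ultimately show ?thesis
    unfolding param_measure_def
    by (intro AE_nonzero_if_separately_polynomial[of _ _ k0] finite_param_index real_polynomial_function_sum
        real_polynomial_function.intros(4) real_polynomial_function.intros(2) real_polynomial_function_fun_upd) simp_all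
qed

lemma param_pair_in_span:
  "((\<Sum>l = 1..n. a l *\<^sub>R V l), (\<Sum>l = 1..n. a l *\<^sub>R W l)) \<in> span ((\<lambda>l. (V l, W l)) ` {1..n})"
proof -
  have "((\<Sum>l = 1..n. a l *\<^sub>R V l), (\<Sum>l = 1..n. a l *\<^sub>R W l)) = (\<Sum>l = 1..n. a l *\<^sub>R (V l, W l))"
    by (simp add: prod_eq_iff fst_sum snd_sum)
  also have "\<dots> \<in> span ((\<lambda>l. (V l, W l)) ` {1..n})"
    by (intro span_sum span_scale span_base) blast
  finally show ?thesis .
qed

lemma reach_space_subset_span:
  assumes "is_basis_matrix n V W (pencil_kernel A B C D i s)"
  shows "reach_space A B C D i s \<subseteq> span (V ` {1..n})"
proof
  fix v assume "v \<in> reach_space A B C D i s"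
  then obtain w where "(v, w) \<in> span ((\<lambda>l. (V l, W l)) ` {1..n})"
    using assms by (auto simp: reach_space_def is_basis_matrix_def)
  then have "v \<in> fst ` span ((\<lambda>l. (V l, W l)) ` {1..n})" by force
  also have "\<dots> = span (V ` {1..n})"
    by (simp add: linear_span_image[OF linear_fst, symmetric] image_image)
  finally show "v \<in> span (V ` {1..n})" .
qed

lemma subspace_sum_subset_span:
  assumes "\<And>q. q \<in> P \<Longrightarrow> R q \<subseteq> span (S q)"
  shows "subspace_sum R P \<subseteq> span (\<Union>q\<in>P. S q)"
proof
  fix x assume "x \<in> subspace_sum R P"
  then obtain f where f: "x = (\<Sum>q\<in>P. f q)" "\<And>q. q \<in> P \<Longrightarrow> f q \<in> R q" by (auto simp: subspace_sum_def)
  have "f q \<in> span (\<Union>q\<in>P. S q)" if "q \<in> P" for q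
    using f(2)[OF that] assms[OF that] span_mono[of "S q" "\<Union>q\<in>P. S q"] that by blast
  then show "x \<in> span (\<Union>q\<in>P. S q)" unfolding f(1) by (rule span_sum)
qed

lemma output_direction_exists:
  fixes A :: "real^'n^'n" and B :: "real^'m^'n" and C :: "real^'n^'p" and D :: "real^'m^'p"
  assumes "right_invertible A B C D" "complex_of_real s \<notin> invariant_zeros A B C D"
    and "is_basis_matrix n V W (pencil_kernel A B C D (Some i) s)"
  shows "\<exists>l\<in>{1..n}. (C *v V l + D *v W l) $ i \<noteq> 0"
proof (rule ccontr)
  assume zero: "\<not> (\<exists>l\<in>{1..n}. (C *v V l + D *v W l) $ i \<noteq> 0)"
  obtain v w where vw: "(A - mat s) *v v + B *v w = 0" "C *v v + D *v w = axis i 1"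
    using pencil_surj_off_invariant_zeros[OF assms(1,2)] .
  then have "(v, w) \<in> pencil_kernel A B C D (Some i) s"
    by (simp add: pencil_kernel_def axis_def del: vector_add_component)
  then have "(v, w) \<in> span ((\<lambda>l. (V l, W l)) ` {1..n})"
    using assms(3) by (simp add: is_basis_matrix_def)
  then obtain a where "(v, w) = (\<Sum>l = 1..n. a l *\<^sub>R (V l, W l))"
    using assms(3) span_indexed_family unfolding is_basis_matrix_def by blast
  then have "v = (\<Sum>l = 1..n. a l *\<^sub>R V l)" "w = (\<Sum>l = 1..n. a l *\<^sub>R W l)"
    by (simp_all add: prod_eq_iff fst_sum snd_sum)
  then have "(C *v v + D *v w) $ i = (\<Sum>l = 1..n. a l * (C *v V l + D *v W l) $ i)"
    by (simp add: linear_sum[OF matrix_vector_mul_linear] linear_cmul[OF matrix_vector_mul_linear]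
        sum.distrib distrib_left)
  also have "\<dots> = 0" using zero by (intro sum.neutral) auto
  finally show False using vw(2) by (simp add: axis_def)
qed

lemma param_feedback_solves_problem_1A:
  fixes A :: "real^'n^'n" and B :: "real^'m^'n" and C :: "real^'n^'p" and D :: "real^'m^'p"
    and V :: "'p option \<Rightarrow> nat \<Rightarrow> nat \<Rightarrow> real^'n" and W :: "'p option \<Rightarrow> nat \<Rightarrow> nat \<Rightarrow> real^'m"
    and \<phi> :: "'n \<Rightarrow> 'p option \<times> nat"
  assumes right_inv: "right_invertible A B C D"
    and no_zero: "steady_state_point td \<notin> invariant_zeros A B C D"
    and eig_stable: "\<forall>(i, j) \<in> eig_index \<nu>. lam i j \<in> real_stability_region td"
    and eig_not_zero: "\<forall>i. \<forall>j\<in>{1..\<nu> (Some i)}.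
                         complex_of_real (lam (Some i) j) \<notin> invariant_zeros A B C D"
    and basis: "\<forall>(i, j) \<in> eig_index \<nu>.
                  is_basis_matrix (d i j) (V i j) (W i j) (pencil_kernel A B C D i (lam i j))"
    and col_order: "bij_betw \<phi> UNIV (eig_index \<nu>)"
    and rank: "rank (param_matrix \<phi> d V k) = CARD('n)"
    and gain: "\<And>i j. j \<in> {1..\<nu> (Some i)} \<Longrightarrow>
      (\<Sum>l = 1..d (Some i) j. k (Some i, j, l) * (C *v V (Some i) j l + D *v W (Some i) j l) $ i) \<noteq> 0"
  shows "solves_problem_1A td A B C D \<nu> lam
           (param_matrix \<phi> d W k ** matrix_inv (param_matrix \<phi> d V k))"
proof -
  define X where "X = param_matrix \<phi> d V k"
  define F where "F = param_matrix \<phi> d W k ** matrix_inv X"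
  define \<gamma> where "\<gamma> c = (case \<phi> c of (None, j) \<Rightarrow> 0 | (Some i, j) \<Rightarrow>
    (C *v column c X + D *v (F *v column c X)) $ i)" for c
  have inv: "invertible X" using rank by (simp add: invertible_det_nz det_eq_0_rank X_def)
  have in_index: "\<phi> c \<in> eig_index \<nu>" for c using col_order by (auto simp: bij_betw_def)
  have "F ** X = param_matrix \<phi> d W k"
    unfolding F_def by (simp add: invertible_matrix_inv[OF inv] flip: matrix_mul_assoc)
  then have FX: "F *v column c X = column c (param_matrix \<phi> d W k)" for c
    by (metis matrix_vector_mul_assoc matrix_vector_mult_basis)
  have kernel: "(column c X, F *v column c X) \<in> pencil_kernel A B C D i (lam i j)"
    if "\<phi> c = (i, j)" for c i j
  proof -
    have "is_basis_matrix (d i j) (V i j) (W i j) (pencil_kernel A B C D i (lam i j))"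
      using basis in_index[of c] that by auto
    then have span: "pencil_kernel A B C D i (lam i j) = span ((\<lambda>l. (V i j l, W i j l)) ` {1..d i j})"
      by (simp add: is_basis_matrix_def)
    show ?thesis
      unfolding FX unfolding X_def column_param_matrix[of \<phi>, OF that] span
      by (rule param_pair_in_span)
  qed
  have closed: "(C + D ** F) *v x = C *v x + D *v (F *v x)" for x
    by (simp add: matrix_vector_mult_add_rdistrib matrix_vector_mul_assoc)
  interpret decoupled_closed_loop A B F X lam \<phi> C D \<nu> \<gamma> td
  proof unfold_locales
    show "invertible X" by (rule inv)
    fix c
    obtain i j where ij: "\<phi> c = (i, j)" by (cases "\<phi> c")
    have "A *v column c X - lam i j *\<^sub>R column c X + B *v (F *v column c X) = 0"
      using kernel[OF ij] by (simp add: pencil_kernel_def matrix_vector_mult_diff_rdistrib mat_mult_vector)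
    then show "(A + B ** F) *v column c X = case_prod lam (\<phi> c) *\<^sub>R column c X"
      by (simp add: ij matrix_vector_mult_add_rdistrib algebra_simps flip: matrix_vector_mul_assoc)
    show "case_prod lam (\<phi> c) \<in> real_stability_region td"
      using eig_stable in_index[of c] by (auto simp: ij)
  next
    fix c j assume "\<phi> c = (None, j)"
    then show "(C + D ** F) *v column c X = 0"
      using kernel[of c None j] by (simp add: pencil_kernel_def closed vec_eq_iff)
  next
    fix c i j assume ij: "\<phi> c = (Some i, j)"
    then show "(C + D ** F) *v column c X = \<gamma> c *\<^sub>R axis i 1"
      using kernel[OF ij] by (auto simp: pencil_kernel_def closed vec_eq_iff \<gamma>_def axis_def)
    have "j \<in> {1..\<nu> (Some i)}" using in_index[of c] ij by (simp add: eig_index_def)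
    then show "\<gamma> c \<noteq> 0"
      using gain[of j i] unfolding \<gamma>_def ij FX
      unfolding X_def column_param_matrix[of \<phi>, OF ij]
      by (simp add: linear_sum[OF matrix_vector_mul_linear] linear_cmul[OF matrix_vector_mul_linear]
          sum.distrib distrib_left)
  qed (rule col_order)
  obtain G :: "real^'p^'m" where "static_gain td (A + B ** F) B (C + D ** F) D ** G = mat 1"
    using right_inverse_static_gain_exists[OF right_inv no_zero closed_loop_invertible] by blast
  then have "solves_problem_1A td A B C D \<nu> lam F"
    unfolding solves_problem_1A_def
    using spectrum_stable tracks_constants error_decoupled eigenstructure_assigned eig_not_zero by blast
  then show ?thesis by (simp add: F_def X_def)
qed

theorem theorem9:
  fixes td :: time_domain
    and A :: "real^'n^'n" and B :: "real^'m^'n" and C :: "real^'n^'p" and D :: "real^'m^'p"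
    and \<nu> :: "'p option \<Rightarrow> nat" and lam :: "'p option \<Rightarrow> nat \<Rightarrow> real"
    and d :: "'p option \<Rightarrow> nat \<Rightarrow> nat"
    and V :: "'p option \<Rightarrow> nat \<Rightarrow> nat \<Rightarrow> real^'n"
    and W :: "'p option \<Rightarrow> nat \<Rightarrow> nat \<Rightarrow> real^'m"
    and \<phi> :: "'n \<Rightarrow> 'p option \<times> nat"
  assumes right_inv: "right_invertible A B C D"
    and stab: "stabilizable td A B"
    and no_zero: "steady_state_point td \<notin> invariant_zeros A B C D"
    and mult: "\<forall>z \<in> invariant_zeros A B C D \<inter> stability_region td.
                 algebraic_multiplicity A B C D z = geometric_multiplicity A B C D z"
    and real_zeros: "invariant_zeros A B C D \<inter> stability_region td \<subseteq> \<real>"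
    and nu_le: "(\<Sum>i\<in>UNIV. \<nu> (Some i)) \<le> CARD('n)"
    and nu_0: "\<nu> None = CARD('n) - (\<Sum>i\<in>UNIV. \<nu> (Some i))"
    and eig_stable: "\<forall>(i, j) \<in> eig_index \<nu>. lam i j \<in> real_stability_region td"
    and eig_not_zero: "\<forall>i. \<forall>j\<in>{1..\<nu> (Some i)}.
                         complex_of_real (lam (Some i) j) \<notin> invariant_zeros A B C D"
    and dims: "\<forall>P \<subseteq> eig_index \<nu>.
                 dim (subspace_sum (\<lambda>(i, j). reach_space A B C D i (lam i j)) P) \<ge> card P"
    and basis: "\<forall>(i, j) \<in> eig_index \<nu>.
                  is_basis_matrix (d i j) (V i j) (W i j) (pencil_kernel A B C D i (lam i j))"
    and col_order: "bij_betw \<phi> UNIV (eig_index \<nu>)"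
  shows "(AE k in param_measure \<nu> d. rank (param_matrix \<phi> d V k) = CARD('n)) \<and>
         (AE k in param_measure \<nu> d. rank (param_matrix \<phi> d V k) = CARD('n) \<longrightarrow>
            solves_problem_1A td A B C D \<nu> lam
              (param_matrix \<phi> d W k ** matrix_inv (param_matrix \<phi> d V k)))"
proof (intro conjI)
  have "AE k in param_measure \<nu> d. det (param_matrix \<phi> d V k) \<noteq> 0"
  proof (rule AE_det_param_matrix[OF col_order])
    fix P assume P: "P \<subseteq> eig_index \<nu>"
    have "subspace_sum (\<lambda>(i, j). reach_space A B C D i (lam i j)) P \<subseteq> span (\<Union>(i, j)\<in>P. V i j ` {1..d i j})"
    proof (rule subspace_sum_subset_span)
      fix q assume "q \<in> P"
      moreover obtain i j where q: "q = (i, j)" by (cases q)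
      ultimately have "is_basis_matrix (d i j) (V i j) (W i j) (pencil_kernel A B C D i (lam i j))"
        using P basis by auto
      then show "(case q of (i, j) \<Rightarrow> reach_space A B C D i (lam i j)) \<subseteq>
          span (case q of (i, j) \<Rightarrow> V i j ` {1..d i j})"
        unfolding q prod.case by (rule reach_space_subset_span)
    qed
    from dim_subset[OF this]
    have "dim (subspace_sum (\<lambda>(i, j). reach_space A B C D i (lam i j)) P)
        \<le> dim (\<Union>(i, j)\<in>P. V i j ` {1..d i j})" by simp
    moreover have "card P \<le> dim (subspace_sum (\<lambda>(i, j). reach_space A B C D i (lam i j)) P)"
      using dims P by blast
    ultimately show "card P \<le> dim (\<Union>(i, j)\<in>P. V i j ` {1..d i j})" by linarith
  qed
  then show "AE k in param_measure \<nu> d. rank (param_matrix \<phi> d V k) = CARD('n)"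
  proof eventually_elim
    case (elim k)
    then show ?case using rank_le_rows[of "param_matrix \<phi> d V k"] by (simp add: det_eq_0_rank)
  qed
  have "AE k in param_measure \<nu> d. \<forall>i. \<forall>j\<in>{1..\<nu> (Some i)}.
      (\<Sum>l = 1..d (Some i) j. k (Some i, j, l) * (C *v V (Some i) j l + D *v W (Some i) j l) $ i) \<noteq> 0"
  proof (intro AE_all_countable[THEN iffD2] allI AE_ball_countable[THEN iffD2] ballI countable_finite finite_atLeastAtMost)
    fix i j assume j: "j \<in> {1..\<nu> (Some i)}"
    then have "is_basis_matrix (d (Some i) j) (V (Some i) j) (W (Some i) j)
        (pencil_kernel A B C D (Some i) (lam (Some i) j))"
      using basis by (auto simp: eig_index_def)
    from output_direction_exists[OF right_inv _ this] eig_not_zero j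
    show "AE k in param_measure \<nu> d.
        (\<Sum>l = 1..d (Some i) j. k (Some i, j, l) * (C *v V (Some i) j l + D *v W (Some i) j l) $ i) \<noteq> 0"
      by (intro AE_linear_form_nonzero) auto
  qed
  then show "AE k in param_measure \<nu> d. rank (param_matrix \<phi> d V k) = CARD('n) \<longrightarrow>
      solves_problem_1A td A B C D \<nu> lam (param_matrix \<phi> d W k ** matrix_inv (param_matrix \<phi> d V k))"
  proof eventually_elim
    case (elim k)
    then show ?case
      using param_feedback_solves_problem_1A[OF right_inv no_zero eig_stable eig_not_zero basis col_order]
      by blast
  qed
qed

end
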